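(* Let $\mathcal{F}$ be a finite nonempty set of Möbius transformations and let $S$ be the semigroup generated by $\mathcal{F}$. The following statements are equivalent: (i) every composition sequence generated by $\mathcal{F}$ is an escaping sequence; (ii) every composition sequence generated by $\mathcal{F}$ converges ideally; (iii) $S$ is semidiscrete and inverse free.
   Context: $\mathbb{H}$ is the upper half-plane and $\overline{\mathbb{R}}=\mathbb{R}\cup\{\infty\}$ its ideal boundary in $\overline{\mathbb{C}}=\mathbb{C}\cup\{\infty\}$, which carries the chordal metric. "Möbius transformation" means a real Möbius transformation $z\mapsto (az+b)/(cz+d)$ with $a,b,c,d\in\mathbb{R}$, $ad-bc>0$; these form the topological group $\mathcal{M}\cong \mathrm{PSL}(2,\mathbb{R})$ (topology of uniform convergence on $\overline{\mathbb{C}}$ in the chordal metric), with identity $I$. A "semigroup" is a nonempty subset of $\mathcal{M}$ closed under composition; the semigroup generated by $\mathcal{F}$ is the set of all finite compositions (of one or more factors) of elements of $\mathcal{F}$. A semigroup $S$ is semidiscrete if $I$ is not an accumulation point of $S$ in $\mathcal{M}$; it is inverse free if the inverse of any member of $S$ is not contained in $S$ (equivalently, $I\notin S$). A composition sequence generated by $\mathcal{F}$ is a sequence $F_n=f_1f_2\dotsb f_n$, $n=1,2,\dotsc$, with $f_i\in\mathcal{F}$ for each $i$. A sequence $(F_n)$ in $\mathcal{M}$ is an escaping sequence if for some (equivalently, every) $w\in\mathbb{H}$ the orbit $(F_n(w))$ has no accumulation point in $\mathbb{H}$ (that is, no subsequence of $(F_n(w))$ converges to a point of $\mathbb{H}$).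 A sequence $(F_n)$ converges ideally if it is an escaping sequence and there is a point $p\in\overline{\mathbb{R}}$ with $F_n(w)\to p$ in the chordal metric for some (equivalently, every) $w\in\mathbb{H}$. *)

theory Defs
  imports "HOL-Analysis.Analysis"
begin

section \<open>The extended complex plane with the chordal metric\<close>

datatype ecomplex = Pt complex | Infty

text \<open>
  Stereographic projection onto the unit sphere of \<open>\<complex> \<times> \<real>\<close>. The product type carries the
  Euclidean metric, so the distance below is the length of the chord between the two images.
\<close>

fun stereo :: "ecomplex \<Rightarrow> complex \<times> real" where
  "stereo (Pt z) =
     (of_real (2 / (1 + (cmod z)\<^sup>2)) * z, ((cmod z)\<^sup>2 - 1) / (1 + (cmod z)\<^sup>2))"
| "stereo Infty = (0, 1)"

lemma stereo_inject: "stereo x = stereo y \<longleftrightarrow> x = y"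
proof
  assume eq: "stereo x = stereo y"
  have pos: "1 + (cmod z)\<^sup>2 > 0" for z
    by (simp add: add_pos_nonneg)
  have snd_Pt: "snd (stereo (Pt z)) = 1 - 2 / (1 + (cmod z)\<^sup>2)" for z
    using pos[of z] by (simp add: field_simps)
  show "x = y"
  proof (cases x; cases y)
    fix z w assume xy: "x = Pt z" "y = Pt w"
    with eq have "snd (stereo (Pt z)) = snd (stereo (Pt w))"
      by simp
    then have "2 / (1 + (cmod z)\<^sup>2) = 2 / (1 + (cmod w)\<^sup>2)"
      unfolding snd_Pt by simp
    moreover have "2 / (1 + (cmod w)\<^sup>2) \<noteq> 0"
      using pos[of w] by simp
    moreover have "of_real (2 / (1 + (cmod z)\<^sup>2)) * z = of_real (2 / (1 + (cmod w)\<^sup>2)) * w"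
      using eq xy by simp
    ultimately have "z = w"
      by (metis mult_left_cancel of_real_eq_0_iff)
    with xy show "x = y" by simp
  next
    fix z assume xy: "x = Pt z" "y = Infty"
    with eq have "snd (stereo (Pt z)) = 1"
      by simp
    then have "2 / (1 + (cmod z)\<^sup>2) = 0"
      unfolding snd_Pt by simp
    with pos[of z] show "x = y" by simp
  next
    fix w assume xy: "x = Infty" "y = Pt w"
    with eq have "snd (stereo (Pt w)) = 1"
      by (metis snd_conv stereo.simps(2))
    then have "2 / (1 + (cmod w)\<^sup>2) = 0"
      unfolding snd_Pt by simp
    with pos[of w] show "x = y" by simp
  qed simp
qed simp

instantiation ecomplex :: metric_space
begin

definition dist_ecomplex :: "ecomplex \<Rightarrow> ecomplex \<Rightarrow> real" where
  "dist_ecomplex x y = dist (stereo x) (stereo y)"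

definition uniformity_ecomplex :: "(ecomplex \<times> ecomplex) filter" where
  "uniformity_ecomplex = (INF e\<in>{0<..}. principal {(x, y). dist x y < e})"

definition open_ecomplex :: "ecomplex set \<Rightarrow> bool" where
  "open_ecomplex U \<longleftrightarrow>
     (\<forall>x\<in>U. eventually (\<lambda>(x', y). x' = x \<longrightarrow> y \<in> U) uniformity)"

instance
proof
  show "dist x y = 0 \<longleftrightarrow> x = y" for x y :: ecomplex
    by (simp add: dist_ecomplex_def stereo_inject)
  show "dist x y \<le> dist x z + dist y z" for x y z :: ecomplex
    by (simp add: dist_ecomplex_def dist_triangle2)
qed (simp_all add: uniformity_ecomplex_def open_ecomplex_def)

end

lemma norm_Pair_power2: "(norm (x, y))\<^sup>2 = (norm x)\<^sup>2 + (norm y)\<^sup>2"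
  by (simp add: norm_Pair)

lemma norm_scaled_Pair_power2:
  "(norm (complex_of_real a * z, t :: real))\<^sup>2 = a\<^sup>2 * (cmod z)\<^sup>2 + t\<^sup>2"
  by (simp add: norm_Pair_power2 norm_mult power_mult_distrib)

lemma norm_stereo: "norm (stereo x) = 1"
proof (cases x)
  case (Pt z)
  define r where "r = (cmod z)\<^sup>2"
  have r: "r \<ge> 0" by (simp add: r_def)
  have "(norm (stereo x))\<^sup>2 = (2 / (1 + r))\<^sup>2 * r + ((r - 1) / (1 + r))\<^sup>2"
    unfolding Pt stereo.simps norm_scaled_Pair_power2 r_def ..
  also have "\<dots> = (4 * r + (r - 1)\<^sup>2) / (1 + r)\<^sup>2"
    by (simp add: power_divide add_divide_distrib)
  also have "4 * r + (r - 1)\<^sup>2 = (1 + r)\<^sup>2"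
    by (simp add: power2_eq_square algebra_simps)
  finally have "(norm (stereo x))\<^sup>2 = 1" using r by simp
  then show ?thesis
    by (smt (verit) norm_ge_zero power2_eq_1_iff)
qed (simp add: norm_Pair)

lemma dist_ecomplex_le_2: "dist x y \<le> 2" for x y :: ecomplex
  using norm_triangle_ineq4[of "stereo x" "stereo y"]
  by (simp add: dist_ecomplex_def dist_norm norm_stereo)

lemma dist_Pt_Infty: "dist (Pt z) Infty = 2 / sqrt (1 + (cmod z)\<^sup>2)"
proof -
  define r where "r = (cmod z)\<^sup>2"
  have r: "r \<ge> 0" by (simp add: r_def)
  have "(dist (Pt z) Infty)\<^sup>2 = (2 / (1 + r))\<^sup>2 * r + ((r - 1) / (1 + r) - 1)\<^sup>2"
    unfolding dist_ecomplex_def dist_norm stereo.simps diff_Pair diff_zero norm_scaled_Pair_power2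
      r_def ..
  also have "(r - 1) / (1 + r) - 1 = - 2 / (1 + r)"
    using r by (simp add: field_simps)
  also have "(2 / (1 + r))\<^sup>2 * r + (- 2 / (1 + r))\<^sup>2 = 4 * (1 + r) / (1 + r)\<^sup>2"
    by (simp add: power_divide add_divide_distrib distrib_left)
  also have "\<dots> = 4 / (1 + r)"
    using r nonzero_mult_divide_mult_cancel_right[of "1 + r" 4 "1 + r"]
    unfolding power2_eq_square by linarith
  also have "\<dots> = (2 / sqrt (1 + r))\<^sup>2"
    using r by (simp add: power_divide)
  finally show ?thesis
    using r by (simp add: r_def power2_eq_iff_nonneg)
qed

lemma dist_Pt_Pt:
  "dist (Pt z) (Pt w) = 2 * cmod (z - w) / (sqrt (1 + (cmod z)\<^sup>2) * sqrt (1 + (cmod w)\<^sup>2))"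
proof -
  define r s where "r = (cmod z)\<^sup>2" and "s = (cmod w)\<^sup>2"
  define t where "t = Re z * Re w + Im z * Im w"
  have r: "r \<ge> 0" "s \<ge> 0" by (simp_all add: r_def s_def)
  have nd: "(cmod (of_real a * z - of_real b * w))\<^sup>2 = a\<^sup>2 * r + b\<^sup>2 * s - 2 * a * b * t" for a b
    unfolding r_def s_def t_def cmod_power2 by (simp add: power2_eq_square algebra_simps)
  from nd[of 1 1] have nd1: "(cmod (z - w))\<^sup>2 = r + s - 2 * t" by simp
  have "(dist (Pt z) (Pt w))\<^sup>2 =
     (cmod (of_real (2 / (1 + r)) * z - of_real (2 / (1 + s)) * w))\<^sup>2
       + ((r - 1) / (1 + r) - (s - 1) / (1 + s))\<^sup>2"
    unfolding dist_ecomplex_def dist_norm stereo.simps diff_Pair norm_Pair_power2 r_def s_def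
    by simp
  also have "\<dots> = 4 * (r + s - 2 * t) / ((1 + r) * (1 + s))"
  proof -
    have "(r - 1) / (1 + r) - (s - 1) / (1 + s) = 2 * (r - s) / ((1 + r) * (1 + s))"
      using r by (simp add: field_simps)
    moreover have "(2 / (1 + r))\<^sup>2 * r + (2 / (1 + s))\<^sup>2 * s - 2 * (2 / (1 + r)) * (2 / (1 + s)) * t
        + (2 * (r - s) / ((1 + r) * (1 + s)))\<^sup>2 = 4 * (r + s - 2 * t) / ((1 + r) * (1 + s))"
    proof -
      have "(2 / p)\<^sup>2 * (p - 1) + (2 / q)\<^sup>2 * (q - 1) - 2 * (2 / p) * (2 / q) * t
          + (2 * ((p - 1) - (q - 1)) / (p * q))\<^sup>2 = 4 * ((p - 1) + (q - 1) - 2 * t) / (p * q)"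
        if "p \<noteq> 0" "q \<noteq> 0" for p q :: real
        using that by (simp add: field_simps power2_eq_square)
      from this[of "1 + r" "1 + s"] show ?thesis
        using r by simp
    qed
    ultimately show ?thesis unfolding nd by simp
  qed
  also have "\<dots> = (2 * cmod (z - w) / (sqrt (1 + r) * sqrt (1 + s)))\<^sup>2"
    using r by (simp add: power_divide power_mult_distrib nd1)
  finally show ?thesis
    using r by (simp add: r_def s_def power2_eq_iff_nonneg)
qed

definition upper_half_plane :: "complex set" where
  "upper_half_plane = {z. Im z > 0}"

definition extended_reals :: "ecomplex set" where
  "extended_reals = insert Infty (range (\<lambda>x::real. Pt (of_real x)))"


section \<open>The group of real Moebius transformations\<close>

text \<open>
  Transformations are maps of the extended plane, so proportional matrices give equal elements.
\<close>

fun moebius :: "real \<Rightarrow> real \<Rightarrow> real \<Rightarrow> real \<Rightarrow> ecomplex \<Rightarrow> ecomplex" where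
  "moebius a b c d (Pt z) =
     (if of_real c * z + of_real d = 0 then Infty
      else Pt ((of_real a * z + of_real b) / (of_real c * z + of_real d)))"
| "moebius a b c d Infty = (if c = 0 then Infty else Pt (of_real (a / c)))"

definition moebius_group :: "(ecomplex \<Rightarrow> ecomplex) set" where
  "moebius_group = {moebius a b c d | a b c d. a * d - b * c > 0}"

lemma id_in_moebius_group: "id \<in> moebius_group"
proof -
  have "id x = moebius 1 0 0 1 x" for x
    by (cases x) auto
  then have "id = moebius 1 0 0 1"
    by blast
  then show ?thesis
    unfolding moebius_group_def by force
qed

lemma moebius_compose:
  assumes "a * d - b * c > 0" and "a' * d' - b' * c' > 0"
  shows "moebius a b c d \<circ> moebius a' b' c' d' =
    moebius (a * a' + b * c') (a * b' + b * d') (c * a' + d * c') (c * b' + d * d')"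
proof
  have det: "a * d \<noteq> b * c" "a' * d' \<noteq> b' * c'"
    using assms by auto
  fix x
  show "(moebius a b c d \<circ> moebius a' b' c' d') x =
    moebius (a * a' + b * c') (a * b' + b * d') (c * a' + d * c') (c * b' + d * d') x"
  proof (cases x)
    case Infty
    show ?thesis
    proof (cases "c' = 0")
      case True
      then have "a' \<noteq> 0" using det by auto
      with True Infty show ?thesis by auto
    next
      case False
      have "of_real c * complex_of_real (a' / c') + of_real d = of_real ((c * a' + d * c') / c')"
        "of_real a * complex_of_real (a' / c') + of_real b = of_real ((a * a' + b * c') / c')"
        using False by (simp_all add: field_simps)
      with False Infty show ?thesis
        by (simp del: of_real_divide of_real_add of_real_mult add: of_real_divide[symmetric])
    qed
  next
    case (Pt z)
    define n m where "n = of_real a' * z + of_real b'" and "m = of_real c' * z + of_real d'"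
    have top: "of_real (a * a' + b * c') * z + of_real (a * b' + b * d') = of_real a * n + of_real b * m"
      and bot: "of_real (c * a' + d * c') * z + of_real (c * b' + d * d') = of_real c * n + of_real d * m"
      by (simp_all add: n_def m_def algebra_simps)
    show ?thesis
    proof (cases "m = 0")
      case True
      have "of_real a' * m - of_real c' * n = complex_of_real (a' * d' - b' * c')"
        by (simp add: n_def m_def algebra_simps)
      then have "n \<noteq> 0"
        using True assms(2) by (metis diff_zero less_irrefl mult_zero_right of_real_eq_0_iff)
      with True show ?thesis
        unfolding Pt o_apply moebius.simps(1) top bot n_def[symmetric] m_def[symmetric]
        by simp
    next
      case False
      have "of_real c * (n / m) + of_real d = (of_real c * n + of_real d * m) / m"
        "of_real a * (n / m) + of_real b = (of_real a * n + of_real b * m) / m"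
        using False by (simp_all add: field_simps)
      with False show ?thesis
        unfolding Pt o_apply moebius.simps(1) top bot n_def[symmetric] m_def[symmetric]
        by simp
    qed
  qed
qed

lemma moebius_group_comp:
  assumes "f \<in> moebius_group" and "g \<in> moebius_group"
  shows "f \<circ> g \<in> moebius_group"
proof -
  obtain a b c d where f: "f = moebius a b c d" "a * d - b * c > 0"
    using assms(1) unfolding moebius_group_def by blast
  obtain a' b' c' d' where g: "g = moebius a' b' c' d'" "a' * d' - b' * c' > 0"
    using assms(2) unfolding moebius_group_def by blast
  have "(a * a' + b * c') * (c * b' + d * d') - (a * b' + b * d') * (c * a' + d * c')
      = (a * d - b * c) * (a' * d' - b' * c')"
    by (simp add: algebra_simps)
  then have "(a * a' + b * c') * (c * b' + d * d') - (a * b' + b * d') * (c * a' + d * c') > 0"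
    using f(2) g(2) by simp
  then show ?thesis
    unfolding f(1) g(1) moebius_compose[OF f(2) g(2)] moebius_group_def by blast
qed

lemma moebius_inverse:
  assumes "a * d - b * c > 0"
  shows "moebius a b c d \<circ> moebius d (- b) (- c) a = id"
proof -
  have det: "d * a - (- b) * (- c) > 0"
    using assms by (simp add: mult.commute)
  define k where "k = a * d - b * c"
  have k: "k \<noteq> 0" using assms by (simp add: k_def)
  have "moebius a b c d \<circ> moebius d (- b) (- c) a = moebius k 0 0 k"
    unfolding moebius_compose[OF assms det] k_def by (simp add: algebra_simps)
  also have "moebius k 0 0 k x = x" for x
    using k by (cases x) auto
  then have "moebius k 0 0 k = id"
    by auto
  finally show ?thesis .
qed

lemma moebius_group_bij_inv:
  assumes "f \<in> moebius_group"
  shows "bij f" and "inv f \<in> moebius_group"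
proof -
  obtain a b c d where f: "f = moebius a b c d" "a * d - b * c > 0"
    using assms unfolding moebius_group_def by blast
  have det: "d * a - (- b) * (- c) > 0"
    using f(2) by (simp add: mult.commute)
  have 1: "f \<circ> moebius d (- b) (- c) a = id"
    using moebius_inverse[OF f(2)] f(1) by simp
  have 2: "moebius d (- b) (- c) a \<circ> f = id"
    using moebius_inverse[OF det] f(1) by simp
  show "bij f"
    using 1 2 o_bij by blast
  have "inv f = moebius d (- b) (- c) a"
    using 1 2 inv_unique_comp by blast
  then show "inv f \<in> moebius_group"
    using det unfolding moebius_group_def by blast
qed

text \<open>
  Uniform convergence in the chordal metric: the sphere is bounded, so every self-map belongs to
  the library's metric space of bounded functions, whose metric is the supremum distance.
\<close>

definition moebius_topology :: "(ecomplex \<Rightarrow> ecomplex) topology" where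
  "moebius_topology = subtopology (mtopology_of (funspace UNIV euclidean_metric)) moebius_group"

lemma mspace_funspace_ecomplex:
  "mspace (funspace UNIV (euclidean_metric :: ecomplex metric)) = (UNIV :: ('a \<Rightarrow> ecomplex) set)"
proof -
  have "bounded (X :: ecomplex set)" for X
    unfolding bounded_def using dist_ecomplex_le_2 by blast
  then show ?thesis
    by (auto simp: Met_TC.fspace_def)
qed

lemma topspace_moebius_topology: "topspace moebius_topology = moebius_group"
  by (simp add: moebius_topology_def mspace_funspace_ecomplex del: mspace_funspace)


section \<open>Semigroups and composition sequences\<close>

inductive_set generated_semigroup ::
  "(ecomplex \<Rightarrow> ecomplex) set \<Rightarrow> (ecomplex \<Rightarrow> ecomplex) set"
  for \<F> where
  generator: "f \<in> \<F> \<Longrightarrow> f \<in> generated_semigroup \<F>"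
| comp: "f \<in> generated_semigroup \<F> \<Longrightarrow> g \<in> generated_semigroup \<F> \<Longrightarrow>
    f \<circ> g \<in> generated_semigroup \<F>"

definition semidiscrete :: "(ecomplex \<Rightarrow> ecomplex) set \<Rightarrow> bool" where
  "semidiscrete S \<longleftrightarrow> id \<notin> moebius_topology derived_set_of S"

definition inverse_free :: "(ecomplex \<Rightarrow> ecomplex) set \<Rightarrow> bool" where
  "inverse_free S \<longleftrightarrow> (\<forall>f\<in>S. inv f \<notin> S)"

text \<open>Indices start at 0, so the entry of index \<open>n\<close> is \<open>f 0 \<circ> f 1 \<circ> \<dots> \<circ> f n\<close>.\<close>

primrec partial_compositions ::
  "(nat \<Rightarrow> ecomplex \<Rightarrow> ecomplex) \<Rightarrow> nat \<Rightarrow> ecomplex \<Rightarrow> ecomplex" where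
  "partial_compositions f 0 = f 0"
| "partial_compositions f (Suc n) = partial_compositions f n \<circ> f (Suc n)"

definition composition_sequence ::
  "(ecomplex \<Rightarrow> ecomplex) set \<Rightarrow> (nat \<Rightarrow> ecomplex \<Rightarrow> ecomplex) \<Rightarrow> bool" where
  "composition_sequence \<F> F \<longleftrightarrow> (\<exists>f. range f \<subseteq> \<F> \<and> F = partial_compositions f)"

definition escaping :: "(nat \<Rightarrow> ecomplex \<Rightarrow> ecomplex) \<Rightarrow> bool" where
  "escaping F \<longleftrightarrow>
     (\<exists>w\<in>upper_half_plane. \<not> (\<exists>r. strict_mono (r :: nat \<Rightarrow> nat) \<and>
        (\<exists>z\<in>upper_half_plane. (\<lambda>n. F (r n) (Pt w)) \<longlonglongrightarrow> Pt z)))"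

definition converges_ideally :: "(nat \<Rightarrow> ecomplex \<Rightarrow> ecomplex) \<Rightarrow> bool" where
  "converges_ideally F \<longleftrightarrow>
     escaping F \<and>
     (\<exists>p\<in>extended_reals. \<exists>w\<in>upper_half_plane. (\<lambda>n. F n (Pt w)) \<longlonglongrightarrow> p)"

end

theory Submission
  imports Defs
begin

text \<open>
  Lift everything to matrices of determinant 1 acting on rows from the right, so that a sequence
  escapes exactly when the norms of its lifts tend to infinity. If one sequence does not escape,
  quotients of members of a convergent subsequence are elements of \<open>S\<close> tending to the identity.
  Conversely, a bounded set of lifts in which every member has a right multiple (by a lift of an
  element of \<open>S\<close>) that is again in the set, a trap, produces a sequence that does not escape;
  elements of \<open>S\<close> near the identity make a ball into a trap.

  Now suppose that there is no trap. If every row were contracted by some lift, then by compactness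
  the contractions would bring any matrix back to a fixed ball, which would be a trap. So some row
  \<open>q\<close> is contracted by no lift, and neither are its images beyond a fixed factor. If two such rows
  are independent and a composition sequence has two distinct limit points on the circle, then rows
  that stay bounded below along the sequence cannot separate the two limit points, since at each
  crossing of the corresponding geodesic the matrices are bounded; yet each of the two arcs contains
  such a row, because a row that does not stay bounded below is approximated by preimages of one of
  the two independent rows. Otherwise \<open>q\<close> is a common eigenvector, \<open>S\<close> acts by affine maps
  without expansion, whose translations all have the same sign, and the translation parts of a
  composition sequence form a monotone sequence up to a convergent correction.
\<close>

section \<open>Two by two matrices acting on rows\<close>

definition cross2 :: "real^2 \<Rightarrow> real^2 \<Rightarrow> real" where
  "cross2 u v = u$1 * v$2 - u$2 * v$1"

definition perp :: "real^2 \<Rightarrow> real^2" where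
  "perp u = vector [- (u$2), u$1]"

definition adjugate :: "real^2^2 \<Rightarrow> real^2^2" where
  "adjugate A = vector [vector [A$2$2, - (A$1$2)], vector [- (A$2$1), A$1$1]]"

lemma inner_real2: "u \<bullet> v = u$1 * v$1 + u$2 * v$2" for u v :: "real^2"
  by (simp add: inner_vec_def sum_2)

lemma norm_real2_power2: "(norm u)\<^sup>2 = (u$1)\<^sup>2 + (u$2)\<^sup>2" for u :: "real^2"
  unfolding power2_norm_eq_inner by (simp add: inner_real2 power2_eq_square)

lemma vector_matrix_mult_2:
  "(u v* A)$1 = u$1 * A$1$1 + u$2 * A$2$1"
  "(u v* A)$2 = u$1 * A$1$2 + u$2 * A$2$2" for A :: "real^2^2"
  by (simp_all add: vector_matrix_mult_def sum_2)

lemma matrix_mult_2: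
  "(A ** B)$i$j = A$i$1 * B$1$j + A$i$2 * B$2$j" for A B :: "real^2^2"
  by (simp add: matrix_matrix_mult_def sum_2)

lemma perp_nth [simp]: "perp u $ 1 = - (u$2)" "perp u $ 2 = u$1"
  by (simp_all add: perp_def)

lemma adjugate_nth [simp]:
  "adjugate A $ 1 $ 1 = A$2$2" "adjugate A $ 1 $ 2 = - (A$1$2)"
  "adjugate A $ 2 $ 1 = - (A$2$1)" "adjugate A $ 2 $ 2 = A$1$1"
  by (simp_all add: adjugate_def)

lemma mat_1_nth_2 [simp]:
  "(mat 1 :: real^2^2) $ 1 $ 1 = 1" "(mat 1 :: real^2^2) $ 1 $ 2 = 0"
  "(mat 1 :: real^2^2) $ 2 $ 1 = 0" "(mat 1 :: real^2^2) $ 2 $ 2 = 1"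
  by (simp_all add: mat_def)

lemma adjugate_mult:
  assumes "det A = 1"
  shows "adjugate A ** A = mat 1" and "A ** adjugate A = mat 1"
  using assms by (simp_all add: vec_eq_iff forall_2 matrix_mult_2 det_2 mult.commute)

lemma norm_perp [simp]: "norm (perp u) = norm u"
proof -
  have "(norm (perp u))\<^sup>2 = (norm u)\<^sup>2"
    by (simp add: norm_real2_power2)
  then show ?thesis by simp
qed

lemma inner_perp [simp]: "u \<bullet> perp u = 0"
  by (simp add: inner_real2)

lemma cross2_perp: "cross2 u (perp u) = (norm u)\<^sup>2"
  unfolding norm_real2_power2 cross2_def by (simp add: power2_eq_square)

lemma cross2_vector_matrix_mult:
  "cross2 (u v* A) (v v* A) = det A * cross2 u v"
  by (simp add: cross2_def vector_matrix_mult_2 det_2 algebra_simps)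

lemma lagrange_identity_2:
  "(u \<bullet> v)\<^sup>2 + (cross2 u v)\<^sup>2 = (norm u)\<^sup>2 * (norm v)\<^sup>2"
  unfolding norm_real2_power2 inner_real2 cross2_def by (simp add: power2_eq_square algebra_simps)

lemma abs_cross2_le: "\<bar>cross2 u v\<bar> \<le> norm u * norm v"
proof (rule power2_le_imp_le)
  show "\<bar>cross2 u v\<bar>\<^sup>2 \<le> (norm u * norm v)\<^sup>2"
    using lagrange_identity_2[of u v] zero_le_power2[of "u \<bullet> v"]
    unfolding power2_abs power_mult_distrib by linarith
qed simp

text \<open>Expansion of \<open>u\<close> in the orthogonal basis \<open>v\<close>,
  \<open>perp v\<close>, cleared of denominators so that \<open>v = 0\<close> needs no
  exception.\<close>

lemma orthogonal_expansion_2: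
  "(norm v)\<^sup>2 *\<^sub>R u = (u \<bullet> v) *\<^sub>R v + cross2 v u *\<^sub>R perp v"
  unfolding vec_eq_iff forall_2 norm_real2_power2 inner_real2 cross2_def
  by (simp add: power2_eq_square algebra_simps)

lemma norm_matrix_2_power2: "(norm A)\<^sup>2 = (norm (A$1))\<^sup>2 + (norm (A$2))\<^sup>2" for A :: "real^2^2"
  unfolding norm_vec_def L2_set_def by (simp add: sum_2)

lemma norm_vector_matrix_mult_le: "norm (u v* A) \<le> norm u * norm A" for A :: "real^2^2"
proof (rule power2_le_imp_le)
  have c: "(u v* A)$j = u \<bullet> column j A" for j
    by (simp add: inner_real2 vector_matrix_mult_def sum_2 column_def)
  have "(norm (u v* A))\<^sup>2 = (u \<bullet> column 1 A)\<^sup>2 + (u \<bullet> column 2 A)\<^sup>2"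
    by (simp add: norm_real2_power2 c)
  also have "\<dots> \<le> (norm u * norm (column 1 A))\<^sup>2 + (norm u * norm (column 2 A))\<^sup>2"
    by (intro add_mono) (metis Cauchy_Schwarz_ineq2 abs_le_square_iff abs_mult abs_norm_cancel)+
  also have "\<dots> = (norm u * norm A)\<^sup>2"
    by (simp add: power_mult_distrib norm_matrix_2_power2 norm_real2_power2 column_def algebra_simps)
  finally show "(norm (u v* A))\<^sup>2 \<le> (norm u * norm A)\<^sup>2" .
qed simp

lemma row_matrix_mult: "(A ** B) $ i = A $ i v* B" for A B :: "real^2^2"
  by (simp add: vec_eq_iff forall_2 matrix_mult_2 vector_matrix_mult_2)

lemma matrix_sub_ldistrib: "A ** (B - C) = A ** B - A ** C" for A B C :: "real^2^2"
  by (simp add: vec_eq_iff forall_2 matrix_mult_2 algebra_simps)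

lemma matrix_minus_right: "A ** (- B) = - (A ** B)" for A B :: "real^2^2"
  by (simp add: vec_eq_iff forall_2 matrix_mult_2)

lemma norm_matrix_mult_le: "norm (A ** B) \<le> norm A * norm B" for A B :: "real^2^2"
proof (rule power2_le_imp_le)
  have "(norm (A ** B))\<^sup>2 \<le> (norm (A$1) * norm B)\<^sup>2 + (norm (A$2) * norm B)\<^sup>2"
    unfolding norm_matrix_2_power2[of "A ** B"] row_matrix_mult
    by (intro add_mono power_mono norm_vector_matrix_mult_le) auto
  also have "\<dots> = (norm A * norm B)\<^sup>2"
    by (simp add: power_mult_distrib norm_matrix_2_power2[of A] algebra_simps)
  finally show "(norm (A ** B))\<^sup>2 \<le> (norm A * norm B)\<^sup>2" .
qed simp

lemma norm_adjugate: "norm (adjugate A) = norm A"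
proof -
  have "(norm (adjugate A))\<^sup>2 = (norm A)\<^sup>2"
    unfolding norm_matrix_2_power2 norm_real2_power2 by simp
  then show ?thesis by simp
qed

text \<open>\<open>A\<close> preserves areas: the square on \<open>u\<close> and
  \<open>perp u\<close> has area |u|^2, and its image has area at most |uA| |u| |A|. So
  \<open>norm A\<close> also controls how much \<open>A\<close> can shrink a row.\<close>

lemma norm_le_norm_vector_matrix_mult:
  fixes A :: "real^2^2"
  assumes "det A = 1"
  shows "norm u \<le> norm (u v* A) * norm A"
proof (cases "u = 0")
  case False
  have "norm u * norm u = cross2 (u v* A) (perp u v* A)"
    using assms by (simp add: cross2_vector_matrix_mult cross2_perp power2_eq_square)
  also have "\<dots> \<le> norm (u v* A) * (norm u * norm A)"
    using abs_cross2_le[of "u v* A" "perp u v* A"] norm_vector_matrix_mult_le[of "perp u" A]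
    by (smt (verit) mult_left_mono norm_ge_zero norm_perp)
  finally have "norm u * norm u \<le> norm u * (norm (u v* A) * norm A)"
    by (simp add: algebra_simps)
  then show ?thesis
    using False by simp
qed simp

lemma norm_matrix_ge_sqrt2:
  assumes "det (A :: real^2^2) = 1"
  shows "(norm A)\<^sup>2 \<ge> 2"
proof -
  have "cross2 (A$1) (A$2) = 1"
    using assms by (simp add: cross2_def det_2)
  then have "1 \<le> norm (A$1) * norm (A$2)"
    using abs_cross2_le[of "A$1" "A$2"] by simp
  moreover have "2 * (norm (A$1) * norm (A$2)) \<le> (norm (A$1))\<^sup>2 + (norm (A$2))\<^sup>2"
    using sum_squares_bound[of "norm (A$1)" "norm (A$2)"] by (simp add: mult.assoc)
  ultimately show ?thesis
    unfolding norm_matrix_2_power2 by linarith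
qed

lemma vector_matrix_mult_nonzero:
  fixes A :: "real^2^2"
  assumes "det A = 1" and "u \<noteq> 0"
  shows "u v* A \<noteq> 0"
  using norm_le_norm_vector_matrix_mult[OF assms(1), of u] assms(2) by auto

section \<open>Rows that are contracted by no element of a semigroup\<close>

text \<open>Besides the contraction rate, the norm of the contracting element is bounded: a
  determinant 1 matrix of norm at most \<open>B\<close> shrinks no row by more than the factor
  \<open>B\<close>, so one step cannot overshoot.\<close>

definition contracts :: "(real^2^2) set \<Rightarrow> real \<Rightarrow> real \<Rightarrow> bool" where
  "contracts \<Gamma> \<theta> B \<longleftrightarrow> (\<forall>u. norm u = 1 \<longrightarrow> (\<exists>g\<in>\<Gamma>. norm (u v* g) \<le> \<theta> \<and> norm g \<le> B))"

lemma tendsto_vector_matrix_mult: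
  fixes A :: "real^2^2"
  assumes "(f \<longlongrightarrow> u) F"
  shows "((\<lambda>x. f x v* A) \<longlongrightarrow> u v* A) F"
  unfolding transpose_matrix_vector[symmetric]
  by (rule bounded_linear.tendsto[OF matrix_vector_mul_bounded_linear assms])

text \<open>Compactness of the unit circle: rows at which ever weaker demands fail would accumulate
  at a row \<open>w\<close>; some \<open>g\<close> contracts \<open>w\<close> strictly, hence by
  continuity also the rows near it.\<close>

lemma uniform_contraction:
  assumes E: "\<And>u. u \<noteq> 0 \<Longrightarrow> \<exists>g\<in>\<Gamma>. norm (u v* g) < norm u"
  shows "\<exists>\<theta> B. 0 < \<theta> \<and> \<theta> < 1 \<and> B \<ge> 1 \<and> contracts \<Gamma> \<theta> B"
proof (rule ccontr)
  assume neg: "\<not> ?thesis"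
  \<comment> \<open>The demands are weakened along rates tending to 1 and norm bounds tending to
    infinity; the shift by 2 keeps the rate strictly between 0 and 1 at
    \<open>n = 0\<close>.\<close>
  have "\<exists>u. norm u = 1 \<and> (\<forall>g\<in>\<Gamma>. norm g \<le> real n + 1 \<longrightarrow> norm (u v* g) > 1 - 1 / (real n + 2))" for n
  proof -
    have "0 < 1 - 1 / (real n + 2)" "1 - 1 / (real n + 2) < 1" "real n + 1 \<ge> 1"
      by (simp_all add: field_simps)
    then have "\<not> contracts \<Gamma> (1 - 1 / (real n + 2)) (real n + 1)"
      using neg by blast
    then show ?thesis
      unfolding contracts_def by (meson not_le)
  qed
  then obtain u where u: "\<And>n. norm (u n) = 1"
    and ug: "\<And>n g. g \<in> \<Gamma> \<Longrightarrow> norm g \<le> real n + 1 \<Longrightarrow> norm (u n v* g) > 1 - 1 / (real n + 2)"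
    by metis
  have "compact (sphere (0::real^2) 1)" "\<And>n. u n \<in> sphere 0 1"
    using u by auto
  then obtain w r where w: "w \<in> sphere 0 1" and r: "strict_mono r" and lim: "(u \<circ> r) \<longlonglongrightarrow> w"
    unfolding compact_def by metis
  obtain g where g: "g \<in> \<Gamma>" "norm (w v* g) < 1"
    using E[of w] w by (metis mem_sphere_0 norm_zero zero_neq_one)
  have l1: "(\<lambda>n. norm ((u \<circ> r) n v* g)) \<longlonglongrightarrow> norm (w v* g)"
    by (intro tendsto_norm tendsto_vector_matrix_mult lim)
  have l2: "(\<lambda>n. 1 - 1 / (real (r n) + 2)) \<longlonglongrightarrow> 1 - 0"
  proof (intro tendsto_diff tendsto_const)
    have "(\<lambda>n. 1 / (real n + 2)) \<longlonglongrightarrow> 0"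
      by real_asymp
    from LIMSEQ_subseq_LIMSEQ[OF this r] show "(\<lambda>n. 1 / (real (r n) + 2)) \<longlonglongrightarrow> 0"
      by (simp add: o_def)
  qed
  have "\<forall>\<^sub>F n in sequentially. 1 - 1 / (real (r n) + 2) \<le> norm ((u \<circ> r) n v* g)"
  proof -
    obtain N where N: "norm g \<le> real N"
      using real_arch_simple by blast
    show ?thesis
    proof (rule eventually_sequentiallyI[of N])
      fix n assume "N \<le> n"
      then have "norm g \<le> real (r n) + 1"
        using N seq_suble[OF r, of n] by linarith
      then show "1 - 1 / (real (r n) + 2) \<le> norm ((u \<circ> r) n v* g)"
        using ug[OF g(1)] by (simp add: less_imp_le)
    qed
  qed
  from tendsto_le[OF trivial_limit_sequentially l1 l2 this] have "1 - 0 \<le> norm (w v* g)" .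
  then show False using g by simp
qed

locale det1_semigroup =
  fixes \<Gamma> :: "(real^2^2) set"
  assumes det1: "A \<in> \<Gamma> \<Longrightarrow> det A = 1"
    and mult_closed: "A \<in> \<Gamma> \<Longrightarrow> B \<in> \<Gamma> \<Longrightarrow> A ** B \<in> \<Gamma>"
begin

context
  fixes \<theta> B :: real
  assumes theta: "0 < \<theta>" "\<theta> < 1" and B1: "B \<ge> 1" and contr: "contracts \<Gamma> \<theta> B"
begin

text \<open>
  Fed with factors that contract the current row \<open>v v* G\<close>, the product \<open>G\<close> has norm comparable to the
  inverse of the norm of that row; the inner product below stays bounded because each step multiplies
  it by at most \<open>\<theta>\<^sup>2\<close> before adding at most \<open>B\<close>.
\<close>

definition tame :: "real^2 \<Rightarrow> real^2^2 \<Rightarrow> bool" where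
  "tame v G \<longleftrightarrow> det G = 1 \<and> \<bar>(v v* G) \<bullet> (perp v v* G)\<bar> \<le> B / (1 - \<theta>\<^sup>2)"

lemma tame_step:
  assumes v: "norm v = 1" and G: "tame v G"
  obtains g where "g \<in> \<Gamma>" "tame v (G ** g)" "norm (v v* (G ** g)) \<le> \<theta> * norm (v v* G)"
    "norm (v v* G) \<le> B * norm (v v* (G ** g))"
proof -
  define C where "C = B / (1 - \<theta>\<^sup>2)"
  have t2: "\<theta>\<^sup>2 < 1"
    using theta by (simp add: power_less_one_iff)
  \<comment> \<open>\<open>C\<close> is the fixed point of the map c |-> c \<theta>^2 + B, so a step
    carries the bound on the inner product to itself.\<close>
  have C: "C * \<theta>\<^sup>2 + B = C"
    using t2 by (simp add: C_def field_simps)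
  define x y where "x = v v* G" and "y = perp v v* G"
  have detG: "det G = 1" and xy: "\<bar>y \<bullet> x\<bar> \<le> C"
    using G by (auto simp: tame_def C_def x_def y_def inner_commute)
  have cr: "cross2 x y = 1"
    using detG v by (simp add: x_def y_def cross2_vector_matrix_mult cross2_perp)
  have x0: "x \<noteq> 0"
    using cr by (auto simp: cross2_def)
  obtain g where g: "g \<in> \<Gamma>" "norm ((x /\<^sub>R norm x) v* g) \<le> \<theta>" "norm g \<le> B"
  proof -
    have "norm (x /\<^sub>R norm x) = 1" using x0 by simp
    then show ?thesis using contr that unfolding contracts_def by blast
  qed
  have xg: "norm (x v* g) \<le> \<theta> * norm x"
    using g(2) x0 unfolding scaleR_vector_matrix_assoc norm_scaleR by (simp add: divide_simps)
  have px: "norm (perp x v* g) \<le> B * norm x"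
    using norm_vector_matrix_mult_le[of "perp x" g] g(3)
    by (smt (verit) mult.commute mult_left_mono norm_ge_zero norm_perp)
  \<comment> \<open>Since the area of \<open>x\<close> and \<open>y\<close> is 1, the component of
    \<open>y\<close> along \<open>perp x\<close> is determined by \<open>x\<close>; the only
    quantity to be controlled is the inner product.\<close>
  have "(norm x)\<^sup>2 *\<^sub>R y = (y \<bullet> x) *\<^sub>R x + perp x"
    using orthogonal_expansion_2[of x y] cr by simp
  then have "(norm x)\<^sup>2 *\<^sub>R (y v* g) = (y \<bullet> x) *\<^sub>R (x v* g) + perp x v* g"
    by (metis scaleR_vector_matrix_assoc vector_matrix_left_distrib)
  then have eq: "(norm x)\<^sup>2 * ((x v* g) \<bullet> (y v* g)) = (y \<bullet> x) * (norm (x v* g))\<^sup>2 + (x v* g) \<bullet> (perp x v* g)"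
    by (metis inner_add_right inner_scaleR_right power2_norm_eq_inner)
  have "(norm x)\<^sup>2 * \<bar>(x v* g) \<bullet> (y v* g)\<bar> = \<bar>(norm x)\<^sup>2 * ((x v* g) \<bullet> (y v* g))\<bar>"
    by (simp add: abs_mult)
  also have "\<dots> \<le> \<bar>(y \<bullet> x) * (norm (x v* g))\<^sup>2\<bar> + \<bar>(x v* g) \<bullet> (perp x v* g)\<bar>"
    unfolding eq by (rule abs_triangle_ineq)
  also have "\<dots> \<le> \<bar>y \<bullet> x\<bar> * (norm (x v* g))\<^sup>2 + norm (x v* g) * norm (perp x v* g)"
    using Cauchy_Schwarz_ineq2[of "x v* g" "perp x v* g"] by (simp add: abs_mult)
  also have "\<dots> \<le> C * (\<theta> * norm x)\<^sup>2 + norm x * (B * norm x)"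
  proof (intro add_mono mult_mono power_mono xy xg px)
    show "norm (x v* g) \<le> norm x"
      using xg mult_right_mono[of \<theta> 1 "norm x"] theta by simp
    show "0 \<le> C" using xy by linarith
  qed simp_all
  also have "\<dots> = (norm x)\<^sup>2 * (C * \<theta>\<^sup>2 + B)"
    by (simp add: power2_eq_square algebra_simps)
  finally have "\<bar>(x v* g) \<bullet> (y v* g)\<bar> \<le> C"
    using x0 unfolding C by simp
  moreover have "det (G ** g) = 1"
    using detG det1[OF g(1)] by (simp add: det_mul)
  ultimately have "tame v (G ** g)"
    by (simp add: tame_def x_def y_def C_def vector_matrix_mul_assoc)
  \<comment> \<open>A factor of determinant 1 and norm at most \<open>B\<close> cannot shrink
    \<open>x\<close> too much; this lower bound lets the contraction be stopped at a prescribed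
    size.\<close>
  moreover have "norm x \<le> B * norm (x v* g)"
    using norm_le_norm_vector_matrix_mult[OF det1[OF g(1)], of x] g(3)
    by (smt (verit) mult.commute mult_left_mono norm_ge_zero)
  ultimately show ?thesis
    using that[OF g(1)] xg by (simp add: x_def vector_matrix_mul_assoc)
qed

text \<open>Repeated tame steps drive the row below \<open>e\<close>, while no single step divides
  its norm by more than \<open>B\<close>. The norms therefore cannot jump over the window from
  \<open>e / B\<close> to \<open>e\<close>.\<close>

lemma tame_reach:
  assumes v: "norm v = 1" and e: "0 < e" "e \<le> 1"
  obtains G where "G \<in> \<Gamma>" "tame v G" "e \<le> B * norm (v v* G)" "norm (v v* G) \<le> e"
proof (rule ccontr)
  assume "\<not> thesis"
  then have neg: "\<not> (e \<le> B * norm (v v* G) \<and> norm (v v* G) \<le> e)" if "G \<in> \<Gamma>" "tame v G" for G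
    using that(1) that(2) \<open>\<And>G. G \<in> \<Gamma> \<Longrightarrow> tame v G \<Longrightarrow> e \<le> B * norm (v v* G) \<Longrightarrow> norm (v v* G) \<le> e \<Longrightarrow> thesis\<close>
    by blast
  \<comment> \<open>The identity is only the starting point and need not lie in \<Gamma>; every
    later product does, so staying outside the window forces the norm to remain at least
    \<open>e\<close>.\<close>
  have "\<exists>G. (G = mat 1 \<or> G \<in> \<Gamma>) \<and> tame v G \<and> e \<le> norm (v v* G) \<and> norm (v v* G) \<le> \<theta> ^ n" for n
  proof (induction n)
    case 0
    have "\<theta>\<^sup>2 < 1"
      using theta by (simp add: power_less_one_iff)
    then have "0 \<le> B / (1 - \<theta>\<^sup>2)"
      using B1 by simp
    then show ?case
      using v e by (intro exI[of _ "mat 1"]) (simp add: tame_def)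
  next
    case (Suc n)
    then obtain G where G: "G = mat 1 \<or> G \<in> \<Gamma>" "tame v G" "e \<le> norm (v v* G)" "norm (v v* G) \<le> \<theta> ^ n"
      by blast
    obtain g where g: "g \<in> \<Gamma>" "tame v (G ** g)" "norm (v v* (G ** g)) \<le> \<theta> * norm (v v* G)"
      "norm (v v* G) \<le> B * norm (v v* (G ** g))"
      using tame_step[OF v G(2)] by blast
    have Gg: "G ** g \<in> \<Gamma>"
      using G(1) g(1) mult_closed by auto
    have "e \<le> norm (v v* (G ** g))"
      using neg[OF Gg g(2)] G(3) g(4) by linarith
    moreover have "norm (v v* (G ** g)) \<le> \<theta> ^ Suc n"
      using g(3) G(4) theta by (smt (verit) mult_left_mono power_Suc)
    ultimately show ?case
      using g(2) Gg by blast
  qed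
  moreover obtain n where "\<theta> ^ n < e"
    using real_arch_pow_inv[OF e(1) theta(2)] by blast
  ultimately show False
    by (smt (verit))
qed

text \<open>Contract the direction \<open>v\<close> of the longer row \<open>h\<close>, of length
  \<open>l\<close>, to size about \<open>1 / l\<close>. Then \<open>h\<close> has length at most 1;
  tameness bounds the image of \<open>perp v\<close> by a multiple of \<open>l\<close>, and the
  shorter row has only a component of size \<open>1 / l\<close> along \<open>perp v\<close>, because
  the rows span area 1.\<close>

lemma cofinal_bound:
  assumes H: "det H = 1"
  shows "\<exists>g\<in>\<Gamma>. norm (H ** g) \<le> 2 + (B / (1 - \<theta>\<^sup>2) + 1) * B"
proof -
  define C where "C = B / (1 - \<theta>\<^sup>2)"
  have "\<theta>\<^sup>2 < 1"
    using theta by (simp add: power_less_one_iff)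
  then have C0: "0 \<le> C"
    using B1 by (simp add: C_def)
  obtain h k where hk: "(h = H$1 \<and> k = H$2) \<or> (h = H$2 \<and> k = H$1)" and le: "norm k \<le> norm h"
    using linear[of "norm (H$1)" "norm (H$2)"] by blast
  \<comment> \<open>The rows may have been swapped, so the area is known only up to sign.\<close>
  have cr: "\<bar>cross2 h k\<bar> = 1"
    using hk H by (auto simp: cross2_def det_2 algebra_simps abs_if)
  have HG: "(norm (H ** G))\<^sup>2 = (norm (h v* G))\<^sup>2 + (norm (k v* G))\<^sup>2" for G :: "real^2^2"
    using hk by (auto simp: norm_matrix_2_power2[of "H ** G"] row_matrix_mult)
  have "1 \<le> norm h * norm k"
    using abs_cross2_le[of h k] cr by simp
  also have "\<dots> \<le> norm h * norm h"
    using le by (simp add: mult_left_mono)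
  finally have l1: "1 \<le> norm h"
    using power2_le_imp_le[of 1 "norm h"] by (simp add: power2_eq_square)
  define l where "l = norm h"
  define v where "v = h /\<^sub>R l"
  have l: "1 \<le> l" "l > 0" using l1 unfolding l_def by linarith+
  have nv: "norm v = 1" using l by (simp add: v_def l_def[symmetric])
  have h: "h = l *\<^sub>R v" using l by (simp add: v_def)
  obtain G where G: "G \<in> \<Gamma>" "tame v G" "1 / l \<le> B * norm (v v* G)" "norm (v v* G) \<le> 1 / l"
    using tame_reach[OF nv, of "1 / l"] l by auto
  define x y where "x = v v* G" and "y = perp v v* G"
  have x: "norm x \<le> 1 / l" "1 / l \<le> B * norm x"
    using G by (simp_all add: x_def)
  have hG: "norm (h v* G) \<le> 1"
    using x(1) l unfolding h x_def scaleR_vector_matrix_assoc norm_scaleR by (simp add: field_simps)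
  have y: "norm y \<le> (C + 1) * B * l"
  proof -
    have "cross2 x y = 1"
      using det1[OF G(1)] nv by (simp add: x_def y_def cross2_vector_matrix_mult cross2_perp)
    \<comment> \<open>Area 1 and inner product at most \<open>C\<close> bound the product of the two
      norms; the lower bound on \<open>norm x\<close> then bounds \<open>norm y\<close>.\<close>
    then have "(norm x * norm y)\<^sup>2 = (x \<bullet> y)\<^sup>2 + 1"
      using lagrange_identity_2[of x y] by (simp add: power_mult_distrib)
    also have "(x \<bullet> y)\<^sup>2 \<le> C\<^sup>2"
      using G(2) unfolding tame_def C_def x_def y_def using abs_le_square_iff by fastforce
    finally have "(norm x * norm y)\<^sup>2 \<le> (C + 1)\<^sup>2"
      using C0 by (simp add: power2_eq_square algebra_simps)
    then have "norm x * norm y \<le> C + 1"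
      using C0 power2_le_imp_le by fastforce
    then have "norm y * (1 / l) \<le> B * (C + 1)"
      using x(2) B1
      by (smt (verit, best) mult.assoc mult.commute mult_left_mono norm_ge_zero)
    then show ?thesis
      using l by (simp add: field_simps)
  qed
  have "k = (k \<bullet> v) *\<^sub>R v + cross2 v k *\<^sub>R perp v"
    using orthogonal_expansion_2[of v k] nv by simp
  then have "k v* G = (k \<bullet> v) *\<^sub>R x + cross2 v k *\<^sub>R y"
    unfolding x_def y_def by (metis scaleR_vector_matrix_assoc vector_matrix_left_distrib)
  then have "norm (k v* G) \<le> \<bar>k \<bullet> v\<bar> * norm x + \<bar>cross2 v k\<bar> * norm y"
    by (metis norm_scaleR norm_triangle_ineq)
  also have "\<dots> \<le> l * (1 / l) + (1 / l) * ((C + 1) * B * l)"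
  proof (intro add_mono mult_mono x y)
    show "\<bar>k \<bullet> v\<bar> \<le> l"
      using Cauchy_Schwarz_ineq2[of k v] nv le by (simp add: l_def)
    have "\<bar>cross2 v k\<bar> = 1 / l"
      using cr l unfolding v_def cross2_def
      by (simp add: divide_simps abs_mult[symmetric] algebra_simps)
    then show "\<bar>cross2 v k\<bar> \<le> 1 / l" by simp
  qed (use l in auto)
  also have "\<dots> = 1 + (C + 1) * B"
    using l by (simp add: field_simps)
  finally have kG: "norm (k v* G) \<le> 1 + (C + 1) * B" .
  have "0 \<le> (C + 1) * B" using C0 B1 by simp
  have "(norm (H ** G))\<^sup>2 \<le> 1\<^sup>2 + (1 + (C + 1) * B)\<^sup>2"
    unfolding HG by (intro add_mono power_mono hG kG) auto
  also have "\<dots> \<le> (2 + (C + 1) * B)\<^sup>2"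
    using \<open>0 \<le> (C + 1) * B\<close> by (simp add: power2_eq_square algebra_simps)
  finally have "norm (H ** G) \<le> 2 + (C + 1) * B"
    using \<open>0 \<le> (C + 1) * B\<close> by (intro power2_le_imp_le[of "norm (H ** G)"]) simp_all
  then show ?thesis
    using G(1) by (auto simp: C_def)
qed

end

end

section \<open>Semigroups without bounded traps\<close>

text \<open>\<open>trapless\<close> is the form in which the hypothesis that all composition
  sequences escape is used: repeated right multiplication inside a bounded trap would give a
  sequence returning to a bounded set forever.\<close>

locale trapless_semigroup = det1_semigroup +
  assumes nonempty: "\<Gamma> \<noteq> {}"
    and trapless: "P \<subseteq> \<Gamma> \<Longrightarrow> P \<noteq> {} \<Longrightarrow> bounded P \<Longrightarrow> \<exists>u\<in>P. \<forall>g\<in>\<Gamma>. u ** g \<notin> P"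
begin

text \<open>If every row were contracted by some element, uniform contraction would let each element
  of \<Gamma> be multiplied back into a fixed ball, and the part of \<Gamma> in that ball would be a
  trap.\<close>

lemma uncontracted_row:
  obtains q where "norm q = 1" "\<And>g. g \<in> \<Gamma> \<Longrightarrow> 1 \<le> norm (q v* g)"
proof -
  have "\<exists>u. u \<noteq> 0 \<and> (\<forall>g\<in>\<Gamma>. norm u \<le> norm (u v* g))"
  proof (rule ccontr)
    assume "\<not> ?thesis"
    then have "\<And>u. u \<noteq> 0 \<Longrightarrow> \<exists>g\<in>\<Gamma>. norm (u v* g) < norm u"
      by (meson not_le)
    from uniform_contraction[OF this] obtain \<theta> B where
      "0 < \<theta>" "\<theta> < 1" "B \<ge> 1" "contracts \<Gamma> \<theta> B" by blast
    from cofinal_bound[OF this] obtain K where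
      K: "\<And>H. det H = 1 \<Longrightarrow> \<exists>g\<in>\<Gamma>. norm (H ** g) \<le> K" by blast
    obtain a where a: "a \<in> \<Gamma>" using nonempty by blast
    \<comment> \<open>The maximum with \<open>norm a\<close> only serves to make \<open>P\<close>
      nonempty.\<close>
    define P where "P = {u\<in>\<Gamma>. norm u \<le> max K (norm a)}"
    have "bounded P"
      unfolding bounded_iff P_def by blast
    moreover have "P \<subseteq> \<Gamma>" "P \<noteq> {}"
      using a by (auto simp: P_def)
    ultimately obtain u where "u \<in> P" "\<forall>g\<in>\<Gamma>. u ** g \<notin> P"
      using trapless by blast
    moreover obtain g where "g \<in> \<Gamma>" "norm (u ** g) \<le> K"
      using K det1 \<open>u \<in> P\<close> by (auto simp: P_def)
    ultimately show False
      by (auto simp: P_def mult_closed)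
  qed
  then obtain u where u: "u \<noteq> 0" "\<And>g. g \<in> \<Gamma> \<Longrightarrow> norm u \<le> norm (u v* g)"
    by blast
  show ?thesis
  proof (rule that[of "u /\<^sub>R norm u"])
    show "1 \<le> norm ((u /\<^sub>R norm u) v* g)" if "g \<in> \<Gamma>" for g
      using u(2)[OF that] u(1) unfolding scaleR_vector_matrix_assoc norm_scaleR by (simp add: divide_simps)
  qed (use u in simp)
qed

end

section \<open>Crossing estimate and normalised Gram forms\<close>

text \<open>If a bounded matrix destroys the positivity of the inner product of \<open>x\<close> and
  \<open>y\<close>, that inner product was at most a multiple of their area: expanding
  \<open>y\<close> along \<open>x\<close>, the area term must outweigh the term with
  \<open>x \<bullet> y\<close> after applying \<open>A\<close>. Lagrange's identity then bounds the
  product of the norms.\<close>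

lemma crossing_bound:
  fixes A :: "real^2^2"
  assumes A: "det A = 1" "norm A \<le> B" and pos: "x \<bullet> y > 0" and neg: "(x v* A) \<bullet> (y v* A) \<le> 0"
  shows "norm x * norm y \<le> (B\<^sup>2 + 1) * \<bar>cross2 x y\<bar>"
proof -
  define d where "d = cross2 x y"
  have x0: "norm x > 0" using pos by auto
  have B0: "0 \<le> B" using A(2) norm_ge_zero order_trans by blast
  have lo: "norm x \<le> norm (x v* A) * B"
    using norm_le_norm_vector_matrix_mult[OF A(1), of x] A(2)
    by (meson mult_left_mono norm_ge_zero order_trans)
  have hi: "norm (perp x v* A) \<le> norm x * B"
    using order_trans[OF norm_vector_matrix_mult_le[of "perp x" A] mult_left_mono[OF A(2)]] by simp
  have xA: "norm (x v* A) > 0"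
    using vector_matrix_mult_nonzero[OF A(1), of x] x0 by auto
  have "(norm x)\<^sup>2 *\<^sub>R y = (x \<bullet> y) *\<^sub>R x + d *\<^sub>R perp x"
    using orthogonal_expansion_2[of x y] by (simp add: d_def inner_commute)
  then have eq: "(norm x)\<^sup>2 *\<^sub>R (y v* A) = (x \<bullet> y) *\<^sub>R (x v* A) + d *\<^sub>R (perp x v* A)"
    by (metis scaleR_vector_matrix_assoc vector_matrix_left_distrib)
  have "(norm x)\<^sup>2 * ((x v* A) \<bullet> (y v* A)) = (x \<bullet> y) * (norm (x v* A))\<^sup>2 + d * ((x v* A) \<bullet> (perp x v* A))"
    using arg_cong[OF eq, of "\<lambda>z. (x v* A) \<bullet> z"]
    by (simp only: inner_add_right inner_scaleR_right power2_norm_eq_inner)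
  moreover have "(norm x)\<^sup>2 * ((x v* A) \<bullet> (y v* A)) \<le> 0"
    using neg by (simp add: mult_nonneg_nonpos)
  ultimately have "(x \<bullet> y) * (norm (x v* A))\<^sup>2 \<le> \<bar>d * ((x v* A) \<bullet> (perp x v* A))\<bar>"
    by linarith
  also have "\<dots> \<le> \<bar>d\<bar> * (norm (x v* A) * (norm x * B))"
    unfolding abs_mult
    by (intro mult_left_mono order_trans[OF Cauchy_Schwarz_ineq2] hi) auto
  finally have "norm (x v* A) * ((x \<bullet> y) * norm (x v* A)) \<le> norm (x v* A) * (\<bar>d\<bar> * (norm x * B))"
    by (simp add: power2_eq_square mult_ac)
  then have *: "(x \<bullet> y) * norm (x v* A) \<le> \<bar>d\<bar> * (norm x * B)"
    using xA by simp
  have "norm x * (x \<bullet> y) \<le> (x \<bullet> y) * norm (x v* A) * B"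
    using mult_left_mono[OF lo, of "x \<bullet> y"] pos by (simp add: mult_ac)
  also have "\<dots> \<le> \<bar>d\<bar> * (norm x * B) * B"
    using * B0 by (rule mult_right_mono)
  finally have "norm x * (x \<bullet> y) \<le> norm x * (B\<^sup>2 * \<bar>d\<bar>)"
    by (simp add: power2_eq_square mult_ac)
  then have le: "x \<bullet> y \<le> B\<^sup>2 * \<bar>d\<bar>"
    using x0 by simp
  have "(norm x * norm y)\<^sup>2 = (x \<bullet> y)\<^sup>2 + \<bar>d\<bar>\<^sup>2"
    using lagrange_identity_2[of x y] by (simp add: power_mult_distrib d_def)
  also have "\<dots> \<le> (B\<^sup>2 * \<bar>d\<bar>)\<^sup>2 + \<bar>d\<bar>\<^sup>2"
    using le pos by (intro add_right_mono power_mono) auto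
  also have "\<dots> \<le> (B\<^sup>2 * \<bar>d\<bar> + \<bar>d\<bar>)\<^sup>2"
    unfolding power2_sum by simp
  finally have "norm x * norm y \<le> B\<^sup>2 * \<bar>d\<bar> + \<bar>d\<bar>"
    by (rule power2_le_imp_le) simp
  then show ?thesis
    by (simp add: d_def algebra_simps)
qed

text \<open>Cramer's rule recovers both rows of \<open>M\<close> from \<open>u v* M\<close> and
  \<open>v v* M\<close>, with coefficients depending only on \<open>u\<close> and
  \<open>v\<close>.\<close>

lemma norm_matrix_le_rows:
  assumes "cross2 u v \<noteq> 0"
  shows "\<exists>K. \<forall>M::real^2^2. norm M \<le> K * (norm (u v* M) + norm (v v* M))"
proof (intro exI allI)
  fix M :: "real^2^2"
  define d where "d = cross2 u v"
  have d: "\<bar>d\<bar> > 0" using assms by (simp add: d_def)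
  have r1: "d *\<^sub>R M$1 = (v$2) *\<^sub>R (u v* M) - (u$2) *\<^sub>R (v v* M)"
    unfolding d_def cross2_def by (simp add: vec_eq_iff forall_2 vector_matrix_mult_2 algebra_simps)
  have r2: "d *\<^sub>R M$2 = (u$1) *\<^sub>R (v v* M) - (v$1) *\<^sub>R (u v* M)"
    unfolding d_def cross2_def by (simp add: vec_eq_iff forall_2 vector_matrix_mult_2 algebra_simps)
  have c: "\<bar>u$1\<bar> \<le> norm u" "\<bar>u$2\<bar> \<le> norm u" "\<bar>v$1\<bar> \<le> norm v" "\<bar>v$2\<bar> \<le> norm v"
    by (simp_all add: component_le_norm_cart)
  have "\<bar>d\<bar> * norm (M$1) \<le> norm v * norm (u v* M) + norm u * norm (v v* M)"
    using norm_triangle_ineq4[of "(v$2) *\<^sub>R (u v* M)" "(u$2) *\<^sub>R (v v* M)"]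
      mult_right_mono[OF c(4), of "norm (u v* M)"] mult_right_mono[OF c(2), of "norm (v v* M)"]
    unfolding r1[symmetric] norm_scaleR by (smt (verit) norm_ge_zero)
  moreover have "\<bar>d\<bar> * norm (M$2) \<le> norm u * norm (v v* M) + norm v * norm (u v* M)"
    using norm_triangle_ineq4[of "(u$1) *\<^sub>R (v v* M)" "(v$1) *\<^sub>R (u v* M)"]
      mult_right_mono[OF c(3), of "norm (u v* M)"] mult_right_mono[OF c(1), of "norm (v v* M)"]
    unfolding r2[symmetric] norm_scaleR by (smt (verit) norm_ge_zero)
  moreover have "norm M \<le> norm (M$1) + norm (M$2)"
    by (rule power2_le_imp_le) (simp_all add: norm_matrix_2_power2 power2_sum)
  then have "\<bar>d\<bar> * norm M \<le> \<bar>d\<bar> * norm (M$1) + \<bar>d\<bar> * norm (M$2)"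
    using d by (simp add: distrib_left[symmetric])
  ultimately have "\<bar>d\<bar> * norm M \<le> (norm v * norm (u v* M) + norm u * norm (v v* M)) +
      (norm u * norm (v v* M) + norm v * norm (u v* M))"
    by (meson add_mono order_trans)
  also have "\<dots> \<le> 2 * (norm u + norm v) * (norm (u v* M) + norm (v v* M))"
    by (simp add: algebra_simps)
  finally show "norm M \<le> (2 * (norm u + norm v) / \<bar>d\<bar>) * (norm (u v* M) + norm (v v* M))"
    using d by (simp add: field_simps)
qed

lemma nonconvergent_two_limits:
  fixes x :: "nat \<Rightarrow> 'a::heine_borel"
  assumes bdd: "bounded (range x)" and nc: "\<not> convergent x"
  obtains a b r s where "a \<noteq> b" "strict_mono (r::nat \<Rightarrow> nat)" "strict_mono (s::nat \<Rightarrow> nat)"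
    "(x \<circ> r) \<longlonglongrightarrow> a" "(x \<circ> s) \<longlonglongrightarrow> b"
proof -
  obtain a r where r: "strict_mono (r::nat \<Rightarrow> nat)" "(x \<circ> r) \<longlonglongrightarrow> a"
    using bounded_imp_convergent_subsequence[OF bdd] by blast
  have "\<not> x \<longlonglongrightarrow> a"
    using nc convergentI by blast
  then obtain e where e: "e > 0" "\<not> (\<forall>\<^sub>F n in sequentially. dist (x n) a < e)"
    unfolding tendsto_iff by blast
  then have "infinite {n. \<not> dist (x n) a < e}"
    by (metis eventually_cofinite cofinite_eq_sequentially)
  then obtain g where g: "strict_mono (g::nat \<Rightarrow> nat)" "\<And>n. \<not> dist (x (g n)) a < e"
    using infinite_enumerate by (metis (mono_tags, lifting) mem_Collect_eq)
  have "bounded (range (x \<circ> g))"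
    using bdd by (rule bounded_subset) auto
  then obtain b h where h: "strict_mono (h::nat \<Rightarrow> nat)" "((x \<circ> g) \<circ> h) \<longlonglongrightarrow> b"
    using bounded_imp_convergent_subsequence by blast
  have "(\<lambda>n. dist (((x \<circ> g) \<circ> h) n) a) \<longlonglongrightarrow> dist b a"
    by (intro tendsto_dist h tendsto_const)
  then have "e \<le> dist b a"
    by (rule tendsto_lowerbound) (use g(2) in \<open>auto simp: not_less\<close>)
  then have "a \<noteq> b" using e by auto
  moreover have "strict_mono (g \<circ> h)" "(x \<circ> (g \<circ> h)) \<longlonglongrightarrow> b"
    using g(1) h by (auto simp: strict_mono_o o_assoc)
  ultimately show ?thesis
    using that r by blast
qed

text \<open>The symmetric form M M^T divided by its trace, which is the squared norm of
  \<open>M\<close>. It encodes the position of the image of \<i> under the Moebius map of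
  \<open>M\<close>, and it stays bounded when \<open>M\<close> does not.\<close>

definition gram :: "real^2^2 \<Rightarrow> real^2 \<Rightarrow> real^2 \<Rightarrow> real" where
  "gram M u v = ((u v* M) \<bullet> (v v* M)) / (norm M)\<^sup>2"

lemma gram_simps:
  "gram M (u + u') v = gram M u v + gram M u' v"
  "gram M v (u + u') = gram M v u + gram M v u'"
  "gram M (c *\<^sub>R u) v = c * gram M u v"
  "gram M v (c *\<^sub>R u) = c * gram M v u"
  by (simp_all add: gram_def vector_matrix_left_distrib inner_add_left inner_add_right
      scaleR_vector_matrix_assoc add_divide_distrib)

lemma gram_commute: "gram M u v = gram M v u"
  by (simp add: gram_def inner_commute)

lemma orthonormal_expansion:
  assumes "norm q = 1"
  shows "u = (u \<bullet> q) *\<^sub>R q + (u \<bullet> perp q) *\<^sub>R perp q"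
proof -
  have "cross2 q u = u \<bullet> perp q"
    by (simp add: cross2_def inner_real2)
  then show ?thesis
    using orthogonal_expansion_2[of q u] assms by simp
qed

lemma norm_matrix_orthonormal_rows:
  fixes M :: "real^2^2"
  assumes "norm q = 1"
  shows "(norm M)\<^sup>2 = (norm (q v* M))\<^sup>2 + (norm (perp q v* M))\<^sup>2"
proof -
  have "(q$1)\<^sup>2 + (q$2)\<^sup>2 = 1"
    using norm_real2_power2[of q] assms by simp
  then have q2: "(q$2)\<^sup>2 = 1 - (q$1)\<^sup>2" by simp
  have "(norm (q v* M))\<^sup>2 + (norm (perp q v* M))\<^sup>2 =
      ((q$1)\<^sup>2 + (q$2)\<^sup>2) * ((M$1$1)\<^sup>2 + (M$1$2)\<^sup>2 + ((M$2$1)\<^sup>2 + (M$2$2)\<^sup>2))"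
    unfolding norm_real2_power2 vector_matrix_mult_2 by (simp add: power2_eq_square algebra_simps)
  then show ?thesis
    unfolding norm_matrix_2_power2 norm_real2_power2 q2 by simp
qed

lemma gram_trace:
  assumes "norm q = 1" "det M = 1"
  shows "gram M q q + gram M (perp q) (perp q) = 1"
proof -
  have "norm M \<noteq> 0" using norm_matrix_ge_sqrt2[OF assms(2)] by auto
  then show ?thesis
    unfolding gram_def power2_norm_eq_inner[symmetric] add_divide_distrib[symmetric]
    unfolding norm_matrix_orthonormal_rows[OF assms(1), of M, symmetric] by simp
qed

text \<open>M M^T has determinant 1, and the normalisation divides it by the fourth power of the
  norm. With trace 1, any limit along diverging norms is a form of rank one.\<close>

lemma gram_det:
  assumes "norm q = 1" "det M = 1"
  shows "gram M q q * gram M (perp q) (perp q) - (gram M q (perp q))\<^sup>2 = 1 / (norm M)^4"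
proof -
  have "cross2 (q v* M) (perp q v* M) = 1"
    using assms by (simp add: cross2_vector_matrix_mult cross2_perp)
  then have "((q v* M) \<bullet> (q v* M)) * ((perp q v* M) \<bullet> (perp q v* M)) - ((q v* M) \<bullet> (perp q v* M))\<^sup>2 = 1"
    using lagrange_identity_2[of "q v* M" "perp q v* M"] by (simp add: power2_norm_eq_inner)
  moreover have "gram M q q * gram M (perp q) (perp q) - (gram M q (perp q))\<^sup>2 =
     (((q v* M) \<bullet> (q v* M)) * ((perp q v* M) \<bullet> (perp q v* M)) - ((q v* M) \<bullet> (perp q v* M))\<^sup>2) / (norm M)^4"
    unfolding gram_def power_divide power_mult[symmetric] diff_divide_distrib times_divide_times_eq
      power_add[symmetric] by simp
  ultimately show ?thesis by simp
qed

lemma abs_gram_le: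
  assumes "norm u = 1" "norm v = 1"
  shows "\<bar>gram M u v\<bar> \<le> 1"
proof (cases "M = 0")
  case False
  have "\<bar>(u v* M) \<bullet> (v v* M)\<bar> \<le> norm M * norm M"
    using order_trans[OF Cauchy_Schwarz_ineq2 mult_mono[OF norm_vector_matrix_mult_le[of u M]
          norm_vector_matrix_mult_le[of v M]]] assms by simp
  with False show ?thesis
    by (simp add: gram_def power2_eq_square)
qed (simp add: gram_def)

text \<open>A symmetric form on the plane has three entries, and trace 1 leaves two of them
  free.\<close>

lemma convergent_gram:
  assumes q: "norm q = 1" and det: "\<And>n. det (M n) = 1"
    and c1: "convergent (\<lambda>n. gram (M n) q q)" and c2: "convergent (\<lambda>n. gram (M n) q (perp q))"
  shows "convergent (\<lambda>n. gram (M n) u v)"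
proof -
  let ?r = "perp q"
  have "gram (M n) u v = (u \<bullet> q) * (v \<bullet> q) * gram (M n) q q
      + ((u \<bullet> q) * (v \<bullet> ?r) + (u \<bullet> ?r) * (v \<bullet> q)) * gram (M n) q ?r
      + (u \<bullet> ?r) * (v \<bullet> ?r) * (1 - gram (M n) q q)" for n
  proof -
    have rr: "gram (M n) ?r ?r = 1 - gram (M n) q q"
      using gram_trace[OF q det[of n]] by simp
    show ?thesis
      unfolding rr[symmetric]
      by (subst orthonormal_expansion[OF q, of u], subst orthonormal_expansion[OF q, of v])
        (simp add: gram_simps gram_commute[of _ ?r q] inner_add_left algebra_simps)
  qed
  then show ?thesis
    by (simp only:, intro convergent_add convergent_mult convergent_const convergent_diff c1 c2)
qed

section \<open>Limit points separated by persistent rows\<close>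

text \<open>A discrete intermediate value argument. The crossing takes place between consecutive
  indices, where the two matrices differ by a single factor.\<close>

lemma frequently_crossing:
  fixes s :: "nat \<Rightarrow> real"
  assumes pos: "\<exists>\<^sub>F n in sequentially. s n > 0" and neg: "\<exists>\<^sub>F n in sequentially. s n \<le> 0"
  shows "\<exists>\<^sub>F n in sequentially. s n > 0 \<and> s (Suc n) \<le> 0"
  unfolding frequently_sequentially
proof
  fix N
  obtain m where m: "m \<ge> N" "s m > 0"
    using pos unfolding frequently_sequentially by blast
  obtain k where k: "k \<ge> m" "s k \<le> 0"
    using neg unfolding frequently_sequentially by blast
  show "\<exists>n\<ge>N. s n > 0 \<and> s (Suc n) \<le> 0"
  proof (rule ccontr)
    assume no: "\<not> ?thesis"
    from k(1) have "s k > 0"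
    proof (induction rule: dec_induct)
      case (step n)
      then show ?case using no m(1) by (meson le_trans not_le)
    qed (fact m)
    with k show False by simp
  qed
qed

locale unbounded_products =
  fixes M A :: "nat \<Rightarrow> real^2^2"
  assumes M_Suc: "M (Suc n) = M n ** A n"
    and det_A: "det (A n) = 1"
    and det_M: "det (M n) = 1"
    and finite_A: "finite (range A)"
    and unbounded: "filterlim (\<lambda>n. norm (M n)) at_top sequentially"
begin

definition persistent :: "real^2 \<Rightarrow> bool" where
  "persistent u \<longleftrightarrow> (\<exists>c>0. \<forall>\<^sub>F n in sequentially. c \<le> norm (u v* M n))"

lemma A_bounded: obtains B where "\<And>n. norm (A n) \<le> B"
proof -
  have "norm (A n) \<le> Max (norm ` range A)" for n
    using finite_A by (intro Max_ge) auto
  then show ?thesis using that by blast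
qed

text \<open>The sign of the inner product tells on which side of the geodesic belonging to
  \<open>u\<close> and \<open>v\<close> the image of \<i> lies. At a crossing the product of the two
  row norms is bounded; both being bounded below, both are bounded above, and so is
  \<open>M n\<close>. Infinitely many crossings contradict divergence of the norms.\<close>

lemma sign_change_not_persistent:
  assumes u: "persistent u" and v: "persistent v" and uv: "cross2 u v \<noteq> 0"
    and pos: "\<exists>\<^sub>F n in sequentially. (u v* M n) \<bullet> (v v* M n) > 0"
    and neg: "\<exists>\<^sub>F n in sequentially. (u v* M n) \<bullet> (v v* M n) < 0"
  shows False
proof -
  obtain B where B: "\<And>n. norm (A n) \<le> B"
    using A_bounded by blast
  obtain K where K: "\<And>M :: real^2^2. norm M \<le> K * (norm (u v* M) + norm (v v* M))"
    using norm_matrix_le_rows[OF uv] by blast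
  obtain c1 where c1: "c1 > 0" "\<forall>\<^sub>F n in sequentially. c1 \<le> norm (u v* M n)"
    using u unfolding persistent_def by blast
  obtain c2 where c2: "c2 > 0" "\<forall>\<^sub>F n in sequentially. c2 \<le> norm (v v* M n)"
    using v unfolding persistent_def by blast
  define D where "D = (B\<^sup>2 + 1) * \<bar>cross2 u v\<bar>"
  have "\<exists>\<^sub>F n in sequentially. (u v* M n) \<bullet> (v v* M n) > 0 \<and> (u v* M (Suc n)) \<bullet> (v v* M (Suc n)) \<le> 0"
    by (rule frequently_crossing[OF pos frequently_mono[OF _ neg]]) simp
  moreover have "\<forall>\<^sub>F n in sequentially. \<bar>K\<bar> * (D / c2 + D / c1) < norm (M n)"
    using unbounded unfolding filterlim_at_top_dense by blast
  then have "\<forall>\<^sub>F n in sequentially. c1 \<le> norm (u v* M n) \<and> c2 \<le> norm (v v* M n) \<and>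
      \<bar>K\<bar> * (D / c2 + D / c1) < norm (M n)"
    using c1(2) c2(2) by (intro eventually_conj)
  ultimately obtain n where n: "c1 \<le> norm (u v* M n)" "c2 \<le> norm (v v* M n)"
      "\<bar>K\<bar> * (D / c2 + D / c1) < norm (M n)"
      "(u v* M n) \<bullet> (v v* M n) > 0" "(u v* M (Suc n)) \<bullet> (v v* M (Suc n)) \<le> 0"
    using frequently_ex[OF frequently_eventually_frequently] by blast
  have "norm (u v* M n) * norm (v v* M n) \<le> D"
    using crossing_bound[OF det_A B, of "u v* M n" "v v* M n" n] n(4,5)
    by (simp add: D_def M_Suc vector_matrix_mul_assoc cross2_vector_matrix_mult det_M)
  moreover have "norm (u v* M n) * c2 \<le> norm (u v* M n) * norm (v v* M n)"
    "c1 * norm (v v* M n) \<le> norm (u v* M n) * norm (v v* M n)"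
    using n(1,2) by (simp_all add: mult_left_mono mult_right_mono)
  ultimately have "norm (u v* M n) \<le> D / c2" "norm (v v* M n) \<le> D / c1"
    using c1(1) c2(1) by (simp_all add: field_simps)
  then have "\<bar>K\<bar> * (norm (u v* M n) + norm (v v* M n)) \<le> \<bar>K\<bar> * (D / c2 + D / c1)"
    by (intro mult_left_mono add_mono) auto
  moreover have "K * (norm (u v* M n) + norm (v v* M n)) \<le> \<bar>K\<bar> * (norm (u v* M n) + norm (v v* M n))"
    by (intro mult_right_mono) auto
  ultimately show False
    using K[of "M n"] n(3) by linarith
qed

text \<open>The bisector \<open>p + q\<close> lies in the double cone. If it is not persistent, some
  \<open>M n\<close> makes it short; the preimages of \<open>y\<close> and \<open>z\<close> under
  this \<open>M n\<close> then span little area with it, while at least one of them is not short.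
  That preimage is nearly parallel to the bisector, hence in the cone, and it is persistent by
  assumption.\<close>

lemma persistent_in_cone:
  assumes p: "norm p = 1" and q: "norm q = 1" and pq: "q \<noteq> - p"
    and y: "cross2 y z \<noteq> 0"
    and per: "\<And>n. persistent (y v* adjugate (M n))" "\<And>n. persistent (z v* adjugate (M n))"
  obtains w where "persistent w" "(w \<bullet> p) * (w \<bullet> q) > 0"
proof (cases "persistent (p + q)")
  case True
  have "p + q \<noteq> 0" using pq by (metis add_eq_0_iff add.commute)
  then have "0 < (p + q) \<bullet> (p + q)" by simp
  also have "\<dots> = 2 * (1 + p \<bullet> q)"
    using p q by (simp add: inner_add_left inner_add_right inner_commute norm_eq_1)
  finally have "0 < 1 + p \<bullet> q" by simp
  moreover have "(p + q) \<bullet> p = 1 + p \<bullet> q" "(p + q) \<bullet> q = 1 + p \<bullet> q"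
    using p q by (simp_all add: inner_add_left norm_eq_1 inner_commute[of q p])
  ultimately have "((p + q) \<bullet> p) * ((p + q) \<bullet> q) > 0" by simp
  with True show ?thesis using that by blast
next
  case False
  define v where "v = p + q"
  define \<delta> where "\<delta> = \<bar>cross2 y z\<bar>"
  have v0: "norm v > 0" using pq by (auto simp: v_def add_eq_0_iff add.commute)
  have d0: "\<delta> > 0" using y by (simp add: \<delta>_def)
  define Y where "Y = norm y + norm z + 1"
  have Y: "Y > 0" "norm y \<le> Y" "norm z \<le> Y"
    by (simp_all add: Y_def add_nonneg_pos)
  \<comment> \<open>Chosen so that \<open>(Y * e)^2\<close> is \<delta> |v|^4 / 8, which is the
    smallness needed in the final estimate.\<close>
  define e where "e = sqrt (\<delta> * (norm v)^4 / 8) / Y"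
  have e: "e > 0" using d0 v0 Y by (simp add: e_def)
  obtain n where n: "norm (v v* M n) < e"
  proof -
    have "\<not> (\<forall>\<^sub>F n in sequentially. e \<le> norm (v v* M n))"
      using False e unfolding persistent_def v_def by blast
    then show ?thesis
      using that eventually_sequentially by (metis not_le)
  qed
  define w1 w2 where "w1 = y v* adjugate (M n)" and "w2 = z v* adjugate (M n)"
  have pull: "w1 v* M n = y" "w2 v* M n = z"
    by (simp_all add: w1_def w2_def vector_matrix_mul_assoc adjugate_mult[OF det_M])
  have cw: "cross2 w x = cross2 (w v* M n) (x v* M n)" for w x
    by (simp add: cross2_vector_matrix_mult det_M)
  have "\<delta> \<le> norm w1 * norm w2"
    using abs_cross2_le[of w1 w2] unfolding cw[of w1 w2] pull \<delta>_def .
  \<comment> \<open>The preimages span the same area \<delta> as \<open>y\<close> and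
    \<open>z\<close>, so they cannot both be short.\<close>
  then have "\<delta> \<le> (norm w1)\<^sup>2 \<or> \<delta> \<le> (norm w2)\<^sup>2"
    by (smt (verit) mult_right_mono mult_left_mono norm_ge_zero power2_eq_square)
  then obtain w x where w: "persistent w" "\<delta> \<le> (norm w)\<^sup>2" "w v* M n = x" "norm x \<le> Y"
    using per pull Y unfolding w1_def w2_def by metis
  have "\<bar>cross2 w v\<bar> \<le> Y * e"
    unfolding cw[of w v] w(3)
    by (intro order_trans[OF abs_cross2_le] mult_mono) (use n w Y in auto)
  then have "\<bar>cross2 w v\<bar>\<^sup>2 \<le> (Y * e)\<^sup>2"
    by (intro power_mono) auto
  also have "\<dots> = \<delta> * (norm v)^4 / 8"
    using Y d0 by (simp add: e_def power_mult_distrib)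
  finally have X: "(cross2 w v)\<^sup>2 \<le> \<delta> * (norm v)^4 / 8" by simp
  \<comment> \<open>With the orthogonal diagonals \<open>v = p + q\<close> and
    \<open>d = p - q\<close> of a rhombus, 4 (w.p)(w.q) = (w.v)^2 - (w.d)^2; a small area with
    \<open>v\<close> makes the second term small.\<close>
  define d where "d = p - q"
  have dv: "d \<bullet> v = 0" "(norm d)\<^sup>2 + (norm v)\<^sup>2 = 4"
    using p q by (simp_all add: d_def v_def power2_norm_eq_inner inner_add_left inner_add_right
        inner_diff_left inner_diff_right inner_commute norm_eq_1)
  have "(norm v)\<^sup>2 * (w \<bullet> d) = - (cross2 v d * cross2 w v)"
  proof -
    have "(norm v)\<^sup>2 *\<^sub>R d = cross2 v d *\<^sub>R perp v"
      using orthogonal_expansion_2[of v d] dv by simp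
    from arg_cong[OF this, of "\<lambda>x. w \<bullet> x"] show ?thesis
      by (simp add: inner_real2[of w "perp v"] cross2_def[of w v] algebra_simps)
  qed
  then have "((norm v)\<^sup>2 * (w \<bullet> d))\<^sup>2 = (cross2 v d)\<^sup>2 * (cross2 w v)\<^sup>2"
    by (simp add: power_mult_distrib)
  also have "(cross2 v d)\<^sup>2 = (norm v)\<^sup>2 * (norm d)\<^sup>2"
    using lagrange_identity_2[of v d] dv by (simp add: inner_commute)
  finally have "(norm v)\<^sup>2 * ((norm v)\<^sup>2 * (w \<bullet> d)\<^sup>2) = (norm v)\<^sup>2 * ((norm d)\<^sup>2 * (cross2 w v)\<^sup>2)"
    by (simp add: power_mult_distrib power2_eq_square mult_ac)
  then have wd: "(norm v)\<^sup>2 * (w \<bullet> d)\<^sup>2 = (norm d)\<^sup>2 * (cross2 w v)\<^sup>2"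
    using v0 by (subst (asm) mult_cancel_left) simp
  have wv: "(w \<bullet> v)\<^sup>2 = (norm w)\<^sup>2 * (norm v)\<^sup>2 - (cross2 w v)\<^sup>2"
    using lagrange_identity_2[of w v] by simp
  have "4 * ((w \<bullet> p) * (w \<bullet> q)) = (w \<bullet> v)\<^sup>2 - (w \<bullet> d)\<^sup>2"
    by (simp add: v_def d_def inner_add_right inner_diff_right power2_eq_square algebra_simps)
  then have "(norm v)\<^sup>2 * (4 * ((w \<bullet> p) * (w \<bullet> q))) =
      (norm v)\<^sup>2 * ((norm w)\<^sup>2 * (norm v)\<^sup>2 - (cross2 w v)\<^sup>2) - (norm d)\<^sup>2 * (cross2 w v)\<^sup>2"
    by (simp add: right_diff_distrib wd wv)
  also have "\<dots> = (norm w)\<^sup>2 * (norm v)^4 - ((norm d)\<^sup>2 + (norm v)\<^sup>2) * (cross2 w v)\<^sup>2"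
    by (simp add: power2_eq_square power4_eq_xxxx algebra_simps)
  also have "\<dots> \<ge> \<delta> * (norm v)^4 - 4 * (\<delta> * (norm v)^4 / 8)"
    unfolding dv(2) by (intro diff_mono mult_right_mono mult_left_mono w X) auto
  finally have "(norm v)\<^sup>2 * (4 * ((w \<bullet> p) * (w \<bullet> q))) \<ge> \<delta> * (norm v)^4 / 2"
    by simp
  moreover have "\<delta> * (norm v)^4 / 2 > 0" using d0 v0 by simp
  ultimately have "(w \<bullet> p) * (w \<bullet> q) > 0"
    by (smt (verit) v0 zero_less_mult_iff zero_less_power)
  with w(1) show ?thesis using that by blast
qed

text \<open>The limit form is positive semidefinite with trace 1 and determinant 0, hence the square
  of a unit linear form. The vector \<open>p\<close>, determined up to sign, represents the limit
  point on the circle.\<close>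

lemma rank_one_limit:
  assumes r: "strict_mono (r :: nat \<Rightarrow> nat)"
    and k1: "(\<lambda>n. gram (M (r n)) e e) \<longlonglongrightarrow> k1" and k2: "(\<lambda>n. gram (M (r n)) e (perp e)) \<longlonglongrightarrow> k2"
    and e: "norm e = 1"
  obtains p where "norm p = 1" "\<And>u v. (\<lambda>n. gram (M (r n)) u v) \<longlonglongrightarrow> (u \<bullet> p) * (v \<bullet> p)"
    "k1 = (e \<bullet> p)\<^sup>2" "k2 = (e \<bullet> p) * (perp e \<bullet> p)"
proof -
  let ?f = "perp e"
  have k3: "(\<lambda>n. gram (M (r n)) ?f ?f) \<longlonglongrightarrow> 1 - k1"
  proof -
    have "gram (M (r n)) ?f ?f = 1 - gram (M (r n)) e e" for n
      using gram_trace[OF e det_M[of "r n"]] by simp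
    then show ?thesis by (simp add: tendsto_diff k1)
  qed
  have "filterlim (\<lambda>n. norm (M (r n))) at_top sequentially"
    using filterlim_compose[OF unbounded filterlim_subseq[OF r]] by simp
  then have "(\<lambda>n. 1 / (norm (M (r n)))^4) \<longlonglongrightarrow> 0"
    by (intro tendsto_divide_0[OF tendsto_const] filterlim_at_top_imp_at_infinity filterlim_pow_at_top) auto
  moreover have "(\<lambda>n. gram (M (r n)) e e * gram (M (r n)) ?f ?f - (gram (M (r n)) e ?f)\<^sup>2)
      \<longlonglongrightarrow> k1 * (1 - k1) - k2\<^sup>2"
    by (intro tendsto_intros k1 k2 k3)
  ultimately have det: "k1 * (1 - k1) = k2\<^sup>2"
    unfolding gram_det[OF e det_M] using LIMSEQ_unique by fastforce
  have "0 \<le> k1" "0 \<le> 1 - k1"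
    by (rule tendsto_lowerbound[OF k1] tendsto_lowerbound[OF k3]; simp add: gram_def)+
  then have k1': "0 \<le> k1" "k1 \<le> 1" by simp_all
  \<comment> \<open>The diagonal entries give the coordinates of \<open>p\<close> only up to sign;
    the off-diagonal entry fixes their relative sign.\<close>
  define c where "c = (if k2 \<ge> 0 then 1 else - 1 :: real)"
  have c: "c * c = 1" "c * \<bar>k2\<bar> = k2" by (auto simp: c_def)
  define p where "p = sqrt k1 *\<^sub>R e + (c * sqrt (1 - k1)) *\<^sub>R ?f"
  have ff: "?f \<bullet> ?f = 1" "e \<bullet> e = 1"
    using e by (simp_all add: power2_norm_eq_inner[symmetric])
  have ep: "e \<bullet> p = sqrt k1" "?f \<bullet> p = c * sqrt (1 - k1)"
    using ff by (simp_all add: p_def inner_add_right inner_commute[of ?f e])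
  have "p \<bullet> p = 1"
    unfolding p_def using ff c(1) k1'
    by (simp add: inner_add_right inner_add_left inner_commute[of ?f e] algebra_simps)
  then have np: "norm p = 1" by (simp add: norm_eq_1)
  have k1_eq: "k1 = (e \<bullet> p)\<^sup>2"
    using k1' by (simp add: ep)
  have k2_eq: "k2 = (e \<bullet> p) * (?f \<bullet> p)"
  proof -
    have "sqrt k1 * sqrt (1 - k1) = \<bar>k2\<bar>"
      by (simp add: real_sqrt_mult[symmetric] det)
    then show ?thesis using c(2) by (simp add: ep mult.left_commute)
  qed
  have k3_eq: "1 - k1 = (?f \<bullet> p)\<^sup>2"
    using k1' c(1) by (simp add: ep power_mult_distrib power2_eq_square[of c])
  have lim: "(\<lambda>n. gram (M (r n)) u v) \<longlonglongrightarrow> (u \<bullet> p) * (v \<bullet> p)" for u v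
  proof -
    have "gram (M (r n)) u v = (u \<bullet> e) * (v \<bullet> e) * gram (M (r n)) e e
      + ((u \<bullet> e) * (v \<bullet> ?f) + (u \<bullet> ?f) * (v \<bullet> e)) * gram (M (r n)) e ?f
      + (u \<bullet> ?f) * (v \<bullet> ?f) * gram (M (r n)) ?f ?f" for n
      by (subst orthonormal_expansion[OF e, of u], subst orthonormal_expansion[OF e, of v])
        (simp add: gram_simps gram_commute[of _ ?f e] inner_add_left algebra_simps)
    moreover have "(u \<bullet> p) * (v \<bullet> p) = (u \<bullet> e) * (v \<bullet> e) * k1
      + ((u \<bullet> e) * (v \<bullet> ?f) + (u \<bullet> ?f) * (v \<bullet> e)) * k2 + (u \<bullet> ?f) * (v \<bullet> ?f) * (1 - k1)"
      unfolding k3_eq unfolding k1_eq k2_eq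
      by (subst orthonormal_expansion[OF e, of u], subst orthonormal_expansion[OF e, of v])
        (simp add: inner_add_left power2_eq_square algebra_simps)
    ultimately show ?thesis
      by (simp only:) (intro tendsto_intros k1 k2 k3)
  qed
  show ?thesis
    by (rule that[OF np lim k1_eq k2_eq])
qed

text \<open>Two limit points p, q would be separated by persistent rows: one row has inner products
  of equal sign with p and q, another of opposite sign. The product of these rows under
  \<open>M n\<close> then has different signs along the two subsequences.\<close>

lemma convergent_gram_two_rows:
  assumes y: "cross2 y z \<noteq> 0"
    and per: "\<And>n. persistent (y v* adjugate (M n))" "\<And>n. persistent (z v* adjugate (M n))"
  shows "convergent (\<lambda>n. gram (M n) u v)"
proof -
  define e :: "real^2" where "e = axis 1 1"
  have e: "norm e = 1" by (simp add: e_def)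
  have f: "norm (perp e) = 1" using e by simp
  define x where "x n = (gram (M n) e e, gram (M n) e (perp e))" for n
  have "convergent x"
  proof (rule ccontr)
    assume "\<not> convergent x"
    moreover have "bounded (range x)"
    proof -
      have "x n \<in> cbox (-1, -1) (1, 1)" for n
        using abs_gram_le[OF e e, of "M n"] abs_gram_le[OF e f, of "M n"]
        by (simp add: x_def abs_le_iff)
      then show ?thesis
        using bounded_cbox bounded_subset by (metis image_subsetI)
    qed
    ultimately obtain a b r s where ab: "a \<noteq> b" and r: "strict_mono (r::nat \<Rightarrow> nat)" and s: "strict_mono (s::nat \<Rightarrow> nat)"
      and lims: "(x \<circ> r) \<longlonglongrightarrow> a" "(x \<circ> s) \<longlonglongrightarrow> b"
      using nonconvergent_two_limits by blast
    have l1: "(\<lambda>n. gram (M (r n)) e e) \<longlonglongrightarrow> fst a" "(\<lambda>n. gram (M (r n)) e (perp e)) \<longlonglongrightarrow> snd a"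
      using tendsto_fst[OF lims(1)] tendsto_snd[OF lims(1)] by (simp_all add: x_def o_def)
    obtain p where p: "norm p = 1"
      "\<And>u v. (\<lambda>n. gram (M (r n)) u v) \<longlonglongrightarrow> (u \<bullet> p) * (v \<bullet> p)"
      "fst a = (e \<bullet> p)\<^sup>2" "snd a = (e \<bullet> p) * (perp e \<bullet> p)"
      using rank_one_limit[OF r l1 e] by blast
    have l2: "(\<lambda>n. gram (M (s n)) e e) \<longlonglongrightarrow> fst b" "(\<lambda>n. gram (M (s n)) e (perp e)) \<longlonglongrightarrow> snd b"
      using tendsto_fst[OF lims(2)] tendsto_snd[OF lims(2)] by (simp_all add: x_def o_def)
    obtain q where q: "norm q = 1"
      "\<And>u v. (\<lambda>n. gram (M (s n)) u v) \<longlonglongrightarrow> (u \<bullet> q) * (v \<bullet> q)"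
      "fst b = (e \<bullet> q)\<^sup>2" "snd b = (e \<bullet> q) * (perp e \<bullet> q)"
      using rank_one_limit[OF s l2 e] by blast
    \<comment> \<open>The limits of the Gram entries depend on \<open>p\<close> and \<open>q\<close>
      only up to sign, so distinct limits exclude both coincidences.\<close>
    have "q \<noteq> p" "q \<noteq> - p"
      using ab p(3,4) q(3,4) by (auto simp: prod_eq_iff)
    obtain w1 where w1: "persistent w1" "(w1 \<bullet> p) * (w1 \<bullet> q) > 0"
      using persistent_in_cone[OF p(1) q(1) \<open>q \<noteq> - p\<close> y per] by blast
    obtain w2 where w2: "persistent w2" "(w2 \<bullet> p) * (w2 \<bullet> (- q)) > 0"
      using persistent_in_cone[OF p(1) _ _ y per, of "- q"] q(1) \<open>q \<noteq> p\<close> by auto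
    \<comment> \<open>Parallel rows would give \<open>(w \<bullet> p) * (w \<bullet> q)\<close> the
      same sign.\<close>
    have cr: "cross2 w1 w2 \<noteq> 0"
    proof
      assume "cross2 w1 w2 = 0"
      then have "(norm w1)\<^sup>2 *\<^sub>R w2 = (w2 \<bullet> w1) *\<^sub>R w1"
        using orthogonal_expansion_2[of w1 w2] by simp
      from arg_cong[OF this, of "\<lambda>z. z \<bullet> x" for x]
      have "(norm w1)\<^sup>2 * (w2 \<bullet> x) = (w2 \<bullet> w1) * (w1 \<bullet> x)" for x
        by simp
      then have "((norm w1)\<^sup>2 * (w2 \<bullet> p)) * ((norm w1)\<^sup>2 * (w2 \<bullet> q)) = (w2 \<bullet> w1)\<^sup>2 * ((w1 \<bullet> p) * (w1 \<bullet> q))"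
        by (simp only:) (simp add: power2_eq_square)
      also have "\<dots> \<ge> 0" using w1(2) by simp
      finally have "(norm w1)^4 * ((w2 \<bullet> p) * (w2 \<bullet> q)) \<ge> 0"
        by (simp add: power4_eq_xxxx power2_eq_square mult_ac)
      moreover have "(norm w1)^4 > 0" using w1 by auto
      then have "(norm w1)^4 * ((w2 \<bullet> p) * (w2 \<bullet> q)) < 0"
        by (rule mult_pos_neg) (use w2(2) in auto)
      ultimately show False by linarith
    qed
    have freq: "\<exists>\<^sub>F n in sequentially. (w1 v* M n) \<bullet> (w2 v* M n) > 0"
      if "strict_mono (t::nat \<Rightarrow> nat)" "(\<lambda>n. gram (M (t n)) w1 w2) \<longlonglongrightarrow> l" "l > 0" for t l
    proof -
      have "\<forall>\<^sub>F n in sequentially. gram (M (t n)) w1 w2 > 0"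
        using that(2,3) by (rule order_tendstoD)
      then have "\<forall>\<^sub>F n in sequentially. (w1 v* M (t n)) \<bullet> (w2 v* M (t n)) > 0"
        by eventually_elim (auto simp: gram_def zero_less_divide_iff)
      then show ?thesis
        unfolding frequently_sequentially eventually_sequentially
        by (metis seq_suble[OF that(1)] le_trans nat_le_linear)
    qed
    have freq': "\<exists>\<^sub>F n in sequentially. (w1 v* M n) \<bullet> (w2 v* M n) < 0"
      if "strict_mono (t::nat \<Rightarrow> nat)" "(\<lambda>n. gram (M (t n)) w1 w2) \<longlonglongrightarrow> l" "l < 0" for t l
    proof -
      have "\<forall>\<^sub>F n in sequentially. gram (M (t n)) w1 w2 < 0"
        using that(2,3) by (rule order_tendstoD)
      then have "\<forall>\<^sub>F n in sequentially. (w1 v* M (t n)) \<bullet> (w2 v* M (t n)) < 0"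
        by eventually_elim (auto simp: gram_def divide_less_0_iff)
      then show ?thesis
        unfolding frequently_sequentially eventually_sequentially
        by (metis seq_suble[OF that(1)] le_trans nat_le_linear)
    qed
    have "((w1 \<bullet> p) * (w1 \<bullet> q)) * ((w2 \<bullet> p) * (w2 \<bullet> q)) < 0"
      using w1(2) w2(2) by (simp add: mult_pos_neg)
    then have "((w1 \<bullet> p) * (w2 \<bullet> p)) * ((w1 \<bullet> q) * (w2 \<bullet> q)) < 0"
      by (simp add: mult_ac)
    then consider "(w1 \<bullet> p) * (w2 \<bullet> p) > 0" "(w1 \<bullet> q) * (w2 \<bullet> q) < 0"
      | "(w1 \<bullet> p) * (w2 \<bullet> p) < 0" "(w1 \<bullet> q) * (w2 \<bullet> q) > 0"
      unfolding mult_less_0_iff by blast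
    then show False
    proof cases
      case 1
      show False
        by (rule sign_change_not_persistent[OF w1(1) w2(1) cr freq[OF r p(2) 1(1)] freq'[OF s q(2) 1(2)]])
    next
      case 2
      show False
        by (rule sign_change_not_persistent[OF w1(1) w2(1) cr freq[OF s q(2) 2(2)] freq'[OF r p(2) 2(1)]])
    qed
  qed
  then obtain l where "x \<longlonglongrightarrow> l"
    unfolding convergent_def by blast
  from tendsto_fst[OF this] tendsto_snd[OF this]
  have "convergent (\<lambda>n. gram (M n) e e)" "convergent (\<lambda>n. gram (M n) e (perp e))"
    unfolding convergent_def x_def by auto
  then show ?thesis
    using convergent_gram[OF e, of M] det_M by blast
qed

end

section \<open>A common eigenvector\<close>

text \<open>Subtracting a suitable multiple of the decreasing weights makes the sequence \<open>t\<close> monotone.\<close>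

lemma drift_dichotomy:
  fixes t w l c :: "nat \<Rightarrow> real"
  assumes w0: "w 0 > 0" and w_Suc: "\<And>n. w (Suc n) = w n * l n"
    and l: "\<And>n. 0 < l n" "\<And>n. l n \<le> 1" "finite (range l)"
    and t_Suc: "\<And>n. t (Suc n) = t n + w n * c n"
    and c: "\<And>n. \<bar>c n\<bar> \<le> C" "\<And>n. l n = 1 \<Longrightarrow> 0 \<le> c n"
  shows "convergent t \<or> filterlim t at_top sequentially"
proof -
  have w: "w n > 0" for n
    by (induction n) (simp_all add: w0 w_Suc l)
  \<comment> \<open>The largest value of \<open>l\<close> below 1; it exists because the range is
    finite, and 0 is inserted so that the maximum is taken over a nonempty set.\<close>
  define L where "L = Max (insert 0 {x \<in> range l. x < 1})"
  have fin: "finite (insert 0 {x \<in> range l. x < 1})" using l(3) by simp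
  have "L \<in> insert 0 {x \<in> range l. x < 1}"
    unfolding L_def using fin by (intro Max_in) auto
  then have L: "L < 1" by auto
  have lL: "l n \<le> L" if "l n \<noteq> 1" for n
    unfolding L_def using fin that l(2)[of n] by (intro Max_ge) auto
  \<comment> \<open>With this \<open>K\<close> the gain K (1 - l n) outweighs the bound
    \<open>C\<close> on \<open>c n\<close> whenever \<open>l n\<close> is below 1; for
    \<open>l n = 1\<close> the increment is nonnegative by assumption.\<close>
  define K where "K = C / (1 - L)"
  have C: "0 \<le> C" using c(1)[of 0] by linarith
  have K: "0 \<le> K" "C = K * (1 - L)" using C L by (simp_all add: K_def)
  define s where "s n = t n - K * w n" for n
  have w_dec: "w (Suc n) \<le> w n" for n
    using w[of n] l(2)[of n] by (simp add: w_Suc mult_left_le)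
  have "s n \<le> s (Suc n)" for n
  proof -
    have "s (Suc n) - s n = w n * (c n + K * (1 - l n))"
      by (simp add: s_def t_Suc w_Suc algebra_simps)
    moreover have "c n + K * (1 - l n) \<ge> 0"
    proof (cases "l n = 1")
      case False
      then have "K * (1 - L) \<le> K * (1 - l n)"
        using lL K(1) by (intro mult_left_mono) auto
      then show ?thesis using c(1)[of n] K(2) by linarith
    qed (simp add: c(2))
    ultimately show ?thesis
      using w[of n] by (smt (verit) mult_nonneg_nonneg)
  qed
  then have s: "incseq s" by (rule incseq_SucI)
  have "decseq w" using w_dec by (rule decseq_SucI)
  then have w_conv: "convergent w"
    using decseq_convergent[of w 0] w unfolding convergent_def by (metis less_imp_le)
  have t: "t n = s n + K * w n" for n by (simp add: s_def)
  show ?thesis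
  proof (cases "\<exists>b. \<forall>n. s n \<le> b")
    case True
    then have "convergent s"
      using incseq_convergent[OF s] unfolding convergent_def by metis
    then have "convergent (\<lambda>n. s n + K * w n)"
      by (intro convergent_add convergent_mult convergent_const w_conv)
    then show ?thesis by (simp add: t[symmetric])
  next
    case False
    have "filterlim s at_top sequentially"
      unfolding filterlim_at_top_dense
    proof
      fix z
      obtain n where "z < s n" using False by (meson not_le)
      then show "\<forall>\<^sub>F m in sequentially. z < s m"
        by (intro eventually_sequentiallyI[of n]) (meson incseqD less_le_trans s)
    qed
    then have "filterlim t at_top sequentially"
      by (rule filterlim_at_top_mono) (use w K in \<open>auto simp: t less_imp_le intro!: always_eventually\<close>)
    then show ?thesis ..
  qed
qed

section \<open>Affine action fixing a boundary point\<close>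

text \<open>For an eigenrow \<open>q\<close> this is the eigenvalue m. In the basis
  \<open>perp q\<close>, \<open>q\<close> the matrix is upper triangular and acts as the affine map
  z |-> z / m^2 + t, whose translation part t is \<open>drift q g\<close>.\<close>

definition multiplier :: "real^2 \<Rightarrow> real^2^2 \<Rightarrow> real" where
  "multiplier q g = (q v* g) \<bullet> q"

definition drift :: "real^2 \<Rightarrow> real^2^2 \<Rightarrow> real" where
  "drift q g = ((perp q v* g) \<bullet> q) / multiplier q g"

definition fixes_row :: "real^2 \<Rightarrow> real^2^2 \<Rightarrow> bool" where
  "fixes_row q g \<longleftrightarrow> det g = 1 \<and> q v* g = multiplier q g *\<^sub>R q"

context
  fixes q :: "real^2"
  assumes q: "norm q = 1"
begin

text \<open>Area preservation forces the second diagonal entry to be the reciprocal of the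
  first.\<close>

lemma fixes_row_perp:
  assumes g: "fixes_row q g"
  shows "multiplier q g \<noteq> 0"
    and "perp q v* g = (1 / multiplier q g) *\<^sub>R perp q + (multiplier q g * drift q g) *\<^sub>R q"
proof -
  let ?m = "multiplier q g" and ?x = "perp q v* g"
  have "cross2 (?m *\<^sub>R q) ?x = 1"
    using g q unfolding fixes_row_def
    by (metis cross2_perp cross2_vector_matrix_mult mult_1 power_one)
  then have m: "?m * (?x \<bullet> perp q) = 1"
    by (simp add: cross2_def inner_real2 algebra_simps)
  then show m0: "?m \<noteq> 0" by auto
  have "?x \<bullet> perp q = 1 / ?m"
    using m m0 by (simp add: field_simps)
  then show "?x = (1 / ?m) *\<^sub>R perp q + (?m * drift q g) *\<^sub>R q"
    using orthonormal_expansion[OF q, of ?x] m0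
    by (metis add.commute drift_def nonzero_mult_div_cancel_left times_divide_eq_right)
qed

lemma fixes_row_mult:
  assumes g: "fixes_row q g" and h: "fixes_row q h"
  shows "fixes_row q (g ** h)"
    and "multiplier q (g ** h) = multiplier q g * multiplier q h"
    and "drift q (g ** h) = drift q g + drift q h / (multiplier q g)\<^sup>2"
proof -
  have qq: "q \<bullet> q = 1" using q by (simp add: norm_eq_1)
  have e: "q v* (g ** h) = (multiplier q g * multiplier q h) *\<^sub>R q"
    using g h unfolding fixes_row_def vector_matrix_mul_assoc[symmetric]
    by (simp add: scaleR_vector_matrix_assoc)
  show m: "multiplier q (g ** h) = multiplier q g * multiplier q h"
    by (simp only: multiplier_def[of q "g ** h"] e) (simp add: qq)
  show "fixes_row q (g ** h)"
    using g h e by (simp add: fixes_row_def m det_mul)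
  have "perp q v* (g ** h) = (1 / multiplier q g) *\<^sub>R (perp q v* h) + (multiplier q g * drift q g) *\<^sub>R (q v* h)"
    unfolding vector_matrix_mul_assoc[symmetric] fixes_row_perp(2)[OF g]
    by (simp add: vector_matrix_left_distrib scaleR_vector_matrix_assoc)
  also have "\<dots> \<bullet> q = multiplier q h * drift q h / multiplier q g + multiplier q g * drift q g * multiplier q h"
    using fixes_row_perp(1)[OF h]
    by (simp add: inner_add_left multiplier_def[of q h, symmetric]) (simp add: drift_def)
  finally show "drift q (g ** h) = drift q g + drift q h / (multiplier q g)\<^sup>2"
    using fixes_row_perp(1)[OF g] fixes_row_perp(1)[OF h]
    by (simp add: drift_def[of q "g ** h"] m power2_eq_square field_simps)
qed

lemma fixes_row_norm:
  assumes g: "fixes_row q g"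
  shows "(norm g)\<^sup>2 = (multiplier q g)\<^sup>2 * (1 + (drift q g)\<^sup>2) + 1 / (multiplier q g)\<^sup>2"
proof -
  let ?m = "multiplier q g"
  have qq: "q \<bullet> q = 1" "perp q \<bullet> perp q = 1" "perp q \<bullet> q = 0"
    using q by (simp_all add: norm_eq_1[symmetric] inner_commute[of "perp q" q])
  have "(norm (perp q v* g))\<^sup>2 = 1 / ?m\<^sup>2 + (?m * drift q g)\<^sup>2"
    unfolding power2_norm_eq_inner fixes_row_perp(2)[OF g]
    by (simp add: inner_add_left inner_add_right qq inner_commute[of q "perp q"] power2_eq_square)
  moreover have "(norm (q v* g))\<^sup>2 = ?m\<^sup>2"
    using g q unfolding fixes_row_def by (metis norm_scaleR mult.right_neutral power2_abs)
  ultimately show ?thesis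
    unfolding norm_matrix_orthonormal_rows[OF q, of g]
    by (simp add: power_mult_distrib algebra_simps)
qed

text \<open>The affine map sends \<i> to t + w \<i>; multiplying numerator and denominator by
  \<open>w\<close> expresses the normalised form through t and w alone.\<close>

lemma fixes_row_gram:
  assumes g: "fixes_row q g"
  defines "w \<equiv> 1 / (multiplier q g)\<^sup>2"
  shows "gram g q q = 1 / (1 + (drift q g)\<^sup>2 + w\<^sup>2)"
    and "gram g q (perp q) = drift q g / (1 + (drift q g)\<^sup>2 + w\<^sup>2)"
    and "w * (norm g)\<^sup>2 = 1 + (drift q g)\<^sup>2 + w\<^sup>2"
proof -
  let ?m = "multiplier q g"
  have m: "?m \<noteq> 0" by (rule fixes_row_perp(1)[OF g])
  then have w: "w > 0" "?m\<^sup>2 * w = 1" by (simp_all add: w_def)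
  show N: "w * (norm g)\<^sup>2 = 1 + (drift q g)\<^sup>2 + w\<^sup>2"
    unfolding fixes_row_norm[OF g] using m by (simp add: w_def field_simps power2_eq_square)
  have qq: "q \<bullet> q = 1" using q by (simp add: norm_eq_1)
  have qg: "q v* g = ?m *\<^sub>R q" using g by (simp add: fixes_row_def)
  have "(q v* g) \<bullet> (q v* g) = ?m\<^sup>2"
    unfolding qg by (simp add: qq power2_eq_square)
  moreover have "(q v* g) \<bullet> (perp q v* g) = ?m\<^sup>2 * drift q g"
    unfolding qg fixes_row_perp(2)[OF g] by (simp add: inner_add_right qq power2_eq_square)
  moreover have "?m\<^sup>2 * x / (norm g)\<^sup>2 = x / (w * (norm g)\<^sup>2)" for x
    using m by (simp add: w_def)
  ultimately show "gram g q q = 1 / (1 + (drift q g)\<^sup>2 + w\<^sup>2)"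
    "gram g q (perp q) = drift q g / (1 + (drift q g)\<^sup>2 + w\<^sup>2)"
    unfolding gram_def N by (metis mult.right_neutral)+
qed

text \<open>If the drifts converge, the relation between \<open>w\<close>, drift and norm forces
  \<open>w\<close> to 0, since the norms diverge. If they diverge in absolute value, both entries
  tend to 0: the limit is the common fixed point.\<close>

lemma convergent_gram_fixed_row:
  assumes g: "\<And>n. fixes_row q (M n)"
    and unb: "filterlim (\<lambda>n. norm (M n)) at_top sequentially"
    and w: "\<And>n. 1 / (multiplier q (M n))\<^sup>2 \<le> W"
    and t: "convergent (\<lambda>n. drift q (M n)) \<or> filterlim (\<lambda>n. \<bar>drift q (M n)\<bar>) at_top sequentially"
  shows "convergent (\<lambda>n. gram (M n) u v)"
proof -
  define t w where "t n = drift q (M n)" and "w n = 1 / (multiplier q (M n))\<^sup>2" for n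
  have qq: "gram (M n) q q = 1 / (1 + (t n)\<^sup>2 + (w n)\<^sup>2)" "gram (M n) q (perp q) = t n / (1 + (t n)\<^sup>2 + (w n)\<^sup>2)" for n
    unfolding t_def w_def by (rule fixes_row_gram[OF g])+
  have N: "w n * (norm (M n))\<^sup>2 = 1 + (t n)\<^sup>2 + (w n)\<^sup>2" for n
    unfolding t_def w_def by (rule fixes_row_gram[OF g])
  have w0: "0 \<le> w n" for n by (simp add: w_def)
  have wW: "w n \<le> W" for n using w by (simp add: w_def)
  have "convergent (\<lambda>n. gram (M n) q q) \<and> convergent (\<lambda>n. gram (M n) q (perp q))"
    using t unfolding t_def[symmetric]
  proof
    assume "convergent t"
    then obtain a where a: "t \<longlonglongrightarrow> a" unfolding convergent_def by blast
    then have "bounded (range t)"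
      using convergent_imp_bounded by blast
    then obtain T where T: "\<And>n. \<bar>t n\<bar> \<le> T"
      unfolding bounded_iff by auto
    have "filterlim (\<lambda>n. (norm (M n))\<^sup>2) at_infinity sequentially"
      by (intro filterlim_at_top_imp_at_infinity filterlim_pow_at_top unb) simp
    then have lim: "(\<lambda>n. (1 + T\<^sup>2 + W\<^sup>2) / (norm (M n))\<^sup>2) \<longlonglongrightarrow> 0"
      by (rule tendsto_divide_0[OF tendsto_const])
    have "w n \<le> (1 + T\<^sup>2 + W\<^sup>2) / (norm (M n))\<^sup>2" for n
    proof -
      have "norm (M n) \<noteq> 0"
        using norm_matrix_ge_sqrt2[of "M n"] g[of n] by (auto simp: fixes_row_def)
      moreover have "w n * (norm (M n))\<^sup>2 \<le> 1 + T\<^sup>2 + W\<^sup>2"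
        unfolding N using power_mono[OF T[of n], of 2] power_mono[OF wW[of n] w0[of n], of 2] by simp
      ultimately show ?thesis by (simp add: pos_le_divide_eq)
    qed
    then have "w \<longlonglongrightarrow> 0"
      by (intro tendsto_sandwich[OF _ _ tendsto_const lim]) (auto simp: w0)
    then have "(\<lambda>n. 1 + (t n)\<^sup>2 + (w n)\<^sup>2) \<longlonglongrightarrow> 1 + a\<^sup>2 + 0\<^sup>2"
      by (intro tendsto_intros a)
    moreover have "1 + a\<^sup>2 + 0\<^sup>2 \<noteq> (0::real)" by (smt (verit) zero_le_power2)
    ultimately show ?thesis
      unfolding qq convergent_def using tendsto_divide[OF tendsto_const] tendsto_divide[OF a] by blast
  next
    assume inf: "filterlim (\<lambda>n. \<bar>t n\<bar>) at_top sequentially"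
    have z: "(\<lambda>n. 1 / \<bar>t n\<bar>) \<longlonglongrightarrow> 0"
      by (intro tendsto_divide_0[OF tendsto_const] filterlim_at_top_imp_at_infinity inf)
    have ev: "\<forall>\<^sub>F n in sequentially. 1 \<le> \<bar>t n\<bar>"
      using inf unfolding filterlim_at_top by blast
    have D: "\<bar>t n\<bar> * \<bar>t n\<bar> \<le> 1 + (t n)\<^sup>2 + (w n)\<^sup>2" for n
      by (simp add: power2_eq_square)
    have "\<forall>\<^sub>F n in sequentially. norm (1 / (1 + (t n)\<^sup>2 + (w n)\<^sup>2)) \<le> 1 / \<bar>t n\<bar>"
      using ev
    proof eventually_elim
      case (elim n)
      have "\<bar>t n\<bar> \<le> \<bar>t n\<bar> * \<bar>t n\<bar>"
        using mult_left_mono[OF elim, of "\<bar>t n\<bar>"] by simp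
      then have "\<bar>t n\<bar> \<le> 1 + (t n)\<^sup>2 + (w n)\<^sup>2" using D[of n] by linarith
      then show ?case using elim by (simp add: frac_le)
    qed
    from Lim_null_comparison[OF this z] have 1: "(\<lambda>n. 1 / (1 + (t n)\<^sup>2 + (w n)\<^sup>2)) \<longlonglongrightarrow> 0" .
    have "\<forall>\<^sub>F n in sequentially. norm (t n / (1 + (t n)\<^sup>2 + (w n)\<^sup>2)) \<le> 1 / \<bar>t n\<bar>"
      using ev
    proof eventually_elim
      case (elim n)
      have "0 < 1 + (t n)\<^sup>2 + (w n)\<^sup>2" by (smt (verit) zero_le_power2)
      then show ?case using D[of n] elim by (simp add: abs_mult field_simps)
    qed
    from Lim_null_comparison[OF this z] have 2: "(\<lambda>n. t n / (1 + (t n)\<^sup>2 + (w n)\<^sup>2)) \<longlonglongrightarrow> 0" .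
    show ?thesis unfolding qq convergent_def using 1 2 by blast
  qed
  then show ?thesis
    using convergent_gram[OF q, of M] g by (simp add: fixes_row_def)
qed

end

section \<open>Composition sequences in a trapless semigroup\<close>

lemma (in det1_semigroup) product_tail:
  assumes M_Suc: "\<And>n. M (Suc n) = M n ** A n" and A_in: "\<And>n. A n \<in> \<Gamma>" and "n < k"
  obtains g where "g \<in> \<Gamma>" "M k = M n ** g"
proof -
  have "\<exists>g\<in>\<Gamma>. M k = M n ** g"
    using \<open>n < k\<close>
  proof (induction k)
    case (Suc k)
    show ?case
    proof (cases "n = k")
      case True
      then show ?thesis using A_in M_Suc by blast
    next
      case False
      then obtain g where "g \<in> \<Gamma>" "M k = M n ** g" using Suc by auto
      then show ?thesis
        using A_in[of k] mult_closed by (metis M_Suc matrix_mul_assoc)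
    qed
  qed simp
  then show ?thesis using that by blast
qed

locale composition_in_semigroup = trapless_semigroup + unbounded_products +
  assumes A_in: "A n \<in> \<Gamma>" and M_0: "M 0 \<in> \<Gamma>"
begin

lemma M_in: "M n \<in> \<Gamma>"
  by (induction n) (simp_all add: M_0 M_Suc mult_closed A_in)

text \<open>For k > n the quotient of \<open>M k\<close> by \<open>M n\<close> is an element of
  \<Gamma>, so a bound valid on all of \<Gamma> holds from index \<open>Suc n\<close>
  onwards.\<close>

lemma persistent_adjugate:
  assumes c: "c > 0" "\<And>g. g \<in> \<Gamma> \<Longrightarrow> c \<le> norm (y v* g)"
  shows "persistent (y v* adjugate (M n))"
  unfolding persistent_def
proof (intro exI conjI)
  show "\<forall>\<^sub>F k in sequentially. c \<le> norm (y v* adjugate (M n) v* M k)"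
  proof (rule eventually_sequentiallyI[of "Suc n"])
    fix k assume "Suc n \<le> k"
    then obtain g where "g \<in> \<Gamma>" "M k = M n ** g"
      using product_tail[of M A n k, OF M_Suc A_in] by auto
    then show "c \<le> norm (y v* adjugate (M n) v* M k)"
      using c(2) adjugate_mult(1)[OF det_M[of n]]
      by (metis matrix_mul_assoc matrix_mul_lid vector_matrix_mul_assoc)
  qed
qed (fact c)

text \<open>Two translations \<open>f\<close> and \<open>h\<close> of opposite directions give a
  trap: the translations in \<Gamma> with drift between those of \<open>h\<close> and
  \<open>f\<close>. A member with nonpositive drift is followed by \<open>f\<close>, any other by
  \<open>h\<close>, and neither leaves the interval.\<close>

lemma drift_one_sided:
  assumes q: "norm q = 1" and fx: "\<And>g. g \<in> \<Gamma> \<Longrightarrow> fixes_row q g"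
    and f: "f \<in> \<Gamma>" "(multiplier q f)\<^sup>2 = 1" "drift q f > 0"
    and h: "h \<in> \<Gamma>" "(multiplier q h)\<^sup>2 = 1"
  shows "drift q h \<ge> 0"
proof (rule ccontr)
  assume "\<not> ?thesis"
  then have neg: "drift q h < 0" by simp
  define P where "P = {g\<in>\<Gamma>. (multiplier q g)\<^sup>2 = 1 \<and> drift q h \<le> drift q g \<and> drift q g \<le> drift q f}"
  have "f \<in> P" using f neg by (simp add: P_def)
  moreover have "bounded P"
    unfolding bounded_iff
  proof (intro exI ballI)
    fix g assume g: "g \<in> P"
    define b where "b = drift q f - drift q h"
    have b: "b \<ge> 0" using f(3) neg by (simp add: b_def)
    have "\<bar>drift q g\<bar> \<le> b" using g f(3) neg by (auto simp: P_def b_def)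
    then have "(drift q g)\<^sup>2 \<le> b\<^sup>2" using abs_le_square_iff[of "drift q g" b] b by simp
    then have "(norm g)\<^sup>2 \<le> 2 + b\<^sup>2"
      using fixes_row_norm[OF q fx, of g] g by (simp add: P_def)
    also have "\<dots> \<le> (2 + b)\<^sup>2" using b by (simp add: power2_sum)
    finally show "norm g \<le> 2 + b" by (rule power2_le_imp_le) (use b in simp)
  qed
  moreover have "\<exists>k\<in>\<Gamma>. g ** k \<in> P" if g: "g \<in> P" for g
  proof (cases "drift q g \<le> 0")
    case True
    have "g ** f \<in> P"
      using g f neg True fixes_row_mult[OF q fx fx, of g f] mult_closed
      by (auto simp: P_def power_mult_distrib)
    then show ?thesis using f by blast
  next
    case False
    have "g ** h \<in> P"
      using g f h neg False fixes_row_mult[OF q fx fx, of g h] mult_closed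
      by (auto simp: P_def power_mult_distrib)
    then show ?thesis using h by blast
  qed
  ultimately show False
    using trapless[of P] by (auto simp: P_def)
qed

text \<open>The composition law adds to the drift of \<open>M n\<close> that of the next factor,
  scaled by the nonincreasing weight \<open>w n\<close>. Factors that are translations all drift in
  one direction, so \<open>drift_dichotomy\<close> applies.\<close>

lemma drift_convergent_or_unbounded:
  assumes q: "norm q = 1" and fx: "\<And>g. g \<in> \<Gamma> \<Longrightarrow> fixes_row q g"
    and mul: "\<And>g. g \<in> \<Gamma> \<Longrightarrow> 1 \<le> (multiplier q g)\<^sup>2"
  shows "convergent (\<lambda>n. drift q (M n)) \<or> filterlim (\<lambda>n. \<bar>drift q (M n)\<bar>) at_top sequentially"
proof -
  define w where "w n = 1 / (multiplier q (M n))\<^sup>2" for n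
  define l where "l n = 1 / (multiplier q (A n))\<^sup>2" for n
  have w0: "w 0 > 0"
    using fixes_row_perp(1)[OF q fx[OF M_0]] by (simp add: w_def)
  have w_Suc: "w (Suc n) = w n * l n" for n
    by (simp add: w_def l_def M_Suc fixes_row_mult(2)[OF q fx fx, OF M_in A_in] power_mult_distrib)
  have l: "0 < l n" "l n \<le> 1" for n
    using fixes_row_perp(1)[OF q fx[OF A_in[of n]]] mul[OF A_in[of n]] by (simp_all add: l_def)
  have "range l = (\<lambda>g. 1 / (multiplier q g)\<^sup>2) ` range A"
    by (auto simp: l_def)
  then have l_fin: "finite (range l)" using finite_A by simp
  have d_Suc: "drift q (M (Suc n)) = drift q (M n) + w n * drift q (A n)" for n
    by (simp add: w_def M_Suc fixes_row_mult(3)[OF q fx fx, OF M_in A_in])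
  define C where "C = Max ((\<lambda>g. \<bar>drift q g\<bar>) ` range A)"
  have C: "\<bar>drift q (A n)\<bar> \<le> C" for n
    unfolding C_def using finite_A by (intro Max_ge) auto
  have l1: "(multiplier q (A n))\<^sup>2 = 1" if "l n = 1" for n
    using that by (simp add: l_def divide_eq_1_iff split: if_splits)
  \<comment> \<open>A translation of positive drift among the factors decides the sign; if there is
    none, the negated drifts satisfy the same hypotheses.\<close>
  show ?thesis
  proof (cases "\<exists>n. (multiplier q (A n))\<^sup>2 = 1 \<and> drift q (A n) > 0")
    case True
    then obtain m where m: "(multiplier q (A m))\<^sup>2 = 1" "drift q (A m) > 0" by blast
    have "0 \<le> drift q (A n)" if "l n = 1" for n
      using drift_one_sided[OF q fx A_in m A_in l1[OF that]] .
    then have "convergent (\<lambda>n. drift q (M n)) \<or> filterlim (\<lambda>n. drift q (M n)) at_top sequentially"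
      by (intro drift_dichotomy[OF w0 w_Suc l l_fin d_Suc C])
    then show ?thesis
      using filterlim_at_top_mono[of "\<lambda>n. drift q (M n)" sequentially "\<lambda>n. \<bar>drift q (M n)\<bar>"]
      by (auto simp: abs_ge_self)
  next
    case False
    have d: "- drift q (M (Suc n)) = - drift q (M n) + w n * (- drift q (A n))" for n
      by (simp add: d_Suc)
    have C': "\<bar>- drift q (A n)\<bar> \<le> C" for n using C by simp
    have "0 \<le> - drift q (A n)" if "l n = 1" for n
      using False l1[OF that] by (metis neg_0_le_iff_le not_le)
    then have "convergent (\<lambda>n. - drift q (M n)) \<or> filterlim (\<lambda>n. - drift q (M n)) at_top sequentially"
      by (intro drift_dichotomy[OF w0 w_Suc l l_fin d C'])
    then show ?thesis
      using filterlim_at_top_mono[of "\<lambda>n. - drift q (M n)" sequentially "\<lambda>n. \<bar>drift q (M n)\<bar>"]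
        convergent_minus_iff[of "\<lambda>n. drift q (M n)"]
      by (auto simp: abs_ge_minus_self)
  qed
qed

text \<open>Images of the uncontracted row \<open>q\<close> are again bounded below under all of
  \<Gamma>. Either some image is independent of \<open>q\<close>, giving two suitable rows, or
  \<open>q\<close> is a common eigenrow whose multipliers have absolute value at least 1.\<close>

lemma convergent_gram_composition: "convergent (\<lambda>n. gram (M n) u v)"
proof -
  obtain q where q: "norm q = 1" "\<And>g. g \<in> \<Gamma> \<Longrightarrow> 1 \<le> norm (q v* g)"
    using uncontracted_row by blast
  show ?thesis
  proof (cases "\<exists>f\<in>\<Gamma>. cross2 q (q v* f) \<noteq> 0")
    case True
    then obtain f where f: "f \<in> \<Gamma>" "cross2 q (q v* f) \<noteq> 0" by blast
    have "1 \<le> norm (q v* f v* g)" if "g \<in> \<Gamma>" for g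
      using q(2)[OF mult_closed[OF f(1) that]] by (simp add: vector_matrix_mul_assoc)
    then show ?thesis
      using convergent_gram_two_rows[OF f(2)] persistent_adjugate[of 1] q(2) by simp
  next
    case False
    have fx: "fixes_row q g" if g: "g \<in> \<Gamma>" for g
    proof -
      have "(q v* g) \<bullet> perp q = cross2 q (q v* g)"
        by (simp add: cross2_def inner_real2)
      then show ?thesis
        using orthonormal_expansion[OF q(1), of "q v* g"] False g det1[OF g]
        by (simp add: fixes_row_def multiplier_def)
    qed
    have mul: "1 \<le> (multiplier q g)\<^sup>2" if g: "g \<in> \<Gamma>" for g
    proof -
      have "norm (q v* g) = \<bar>multiplier q g\<bar>"
        using fx[OF g] q(1) unfolding fixes_row_def by (metis mult.right_neutral norm_scaleR)
      then show ?thesis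
        using q(2)[OF g] by (simp add: one_le_power abs_le_square_iff[of 1, simplified])
    qed
    show ?thesis
    proof (rule convergent_gram_fixed_row[OF q(1) fx[OF M_in] unbounded])
      show "1 / (multiplier q (M n))\<^sup>2 \<le> 1" for n
        using mul[OF M_in[of n]] by (intro divide_le_eq_1[THEN iffD2]) auto
    qed (rule drift_convergent_or_unbounded[OF q(1) fx mul])
  qed
qed

end

section \<open>Moebius transformations as matrices\<close>

definition mob :: "real^2^2 \<Rightarrow> ecomplex \<Rightarrow> ecomplex" where
  "mob A = moebius (A$1$1) (A$1$2) (A$2$1) (A$2$2)"

lemma mob_mult: "det A = 1 \<Longrightarrow> det B = 1 \<Longrightarrow> mob (A ** B) = mob A \<circ> mob B"
  unfolding mob_def by (subst moebius_compose) (simp_all add: det_2 matrix_mult_2)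

lemma moebius_scale:
  assumes "k \<noteq> 0"
  shows "moebius (k * a) (k * b) (k * c) (k * d) = moebius a b c d"
proof
  have *: "of_real (k * x) * z + of_real (k * y) = of_real k * (of_real x * z + of_real y)" for x y z
    by (simp add: algebra_simps)
  fix x show "moebius (k * a) (k * b) (k * c) (k * d) x = moebius a b c d x"
    using assms by (cases x) (simp_all add: * del: of_real_mult)
qed

lemma moebius_group_mob:
  assumes "f \<in> moebius_group"
  shows "\<exists>A. det A = 1 \<and> mob A = f"
proof -
  obtain a b c d where f: "f = moebius a b c d" and D: "a * d - b * c > 0"
    using assms unfolding moebius_group_def by blast
  define k where "k = 1 / sqrt (a * d - b * c)"
  have k: "k \<noteq> 0" "k * k * (a * d - b * c) = 1"
    using D by (simp_all add: k_def)
  let ?A = "vector [vector [k * a, k * b], vector [k * c, k * d]] :: real^2^2"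
  have "det ?A = 1" using k(2) by (simp add: det_2 algebra_simps)
  moreover have "mob ?A = f" unfolding f mob_def by (simp add: moebius_scale[OF k(1)])
  ultimately show ?thesis by blast
qed

definition hmap :: "real^2^2 \<Rightarrow> complex \<Rightarrow> complex" where
  "hmap A w = (of_real (A$1$1) * w + of_real (A$1$2)) / (of_real (A$2$1) * w + of_real (A$2$2))"

lemma hmap_denominator:
  fixes A :: "real^2^2"
  assumes "det A = 1" "Im w > 0"
  shows "of_real (A$2$1) * w + of_real (A$2$2) \<noteq> 0"
proof
  assume 0: "of_real (A$2$1) * w + of_real (A$2$2) = 0"
  from arg_cong[OF this, of Im] have "A$2$1 = 0" using assms(2) by simp
  with 0 have "A$2$2 = 0" by simp
  with \<open>A$2$1 = 0\<close> show False using assms(1) by (simp add: det_2)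
qed

lemma mob_Pt:
  assumes "det A = 1" "Im w > 0"
  shows "mob A (Pt w) = Pt (hmap A w)"
  using hmap_denominator[OF assms] by (simp add: mob_def hmap_def)

lemma Im_hmap:
  assumes "det A = 1" "Im w > 0"
  shows "Im (hmap A w) > 0"
proof -
  let ?n = "of_real (A$1$1) * w + of_real (A$1$2)" and ?m = "of_real (A$2$1) * w + of_real (A$2$2)"
  have "Im ?n * Re ?m - Re ?n * Im ?m = det A * Im w"
    by (simp add: det_2 algebra_simps)
  moreover have "(Re ?m)\<^sup>2 + (Im ?m)\<^sup>2 > 0"
    using hmap_denominator[OF assms] unfolding cmod_power2[symmetric] by simp
  ultimately show ?thesis
    using assms unfolding hmap_def Im_divide by simp
qed

section \<open>Orbits in the half-plane and norms of lifts\<close>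

lemma tendsto_Pt:
  assumes "(f \<longlongrightarrow> z) F"
  shows "((\<lambda>x. Pt (f x)) \<longlongrightarrow> Pt z) F"
proof (rule Lim_null_comparison[THEN tendsto_dist_iff[THEN iffD2]])
  have "dist (Pt x) (Pt z) \<le> 2 * cmod (x - z)" for x
  proof -
    have "1 \<le> sqrt (1 + (cmod x)\<^sup>2) * sqrt (1 + (cmod z)\<^sup>2)"
      by (intro mult_ge1_I) simp_all
    then show ?thesis
      unfolding dist_Pt_Pt by (intro divide_le_eq[THEN iffD2]) (simp add: mult_le_cancel_left1 split: if_splits)
  qed
  then show "\<forall>\<^sub>F x in F. norm (dist (Pt (f x)) (Pt z)) \<le> 2 * cmod (f x - z)"
    by simp
  show "((\<lambda>x. 2 * cmod (f x - z)) \<longlongrightarrow> 0) F"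
    using tendsto_norm_zero[OF LIM_zero[OF assms]] tendsto_mult_right_zero by blast
qed

lemma tendsto_stereo_iff: "((\<lambda>n. stereo (f n)) \<longlongrightarrow> stereo x) F \<longleftrightarrow> (f \<longlongrightarrow> x) F"
  unfolding tendsto_dist_iff[of f] tendsto_dist_iff[of "\<lambda>n. stereo (f n)"] dist_ecomplex_def ..

lemmas tendsto_stereo = tendsto_stereo_iff[THEN iffD2]

lemma tendsto_hmap:
  assumes A: "(A \<longlongrightarrow> B) F" and B: "det B = 1" and w: "Im w > 0"
  shows "((\<lambda>n. hmap (A n) w) \<longlongrightarrow> hmap B w) F"
  unfolding hmap_def
  by (intro tendsto_intros A hmap_denominator[OF B w])

lemma tendsto_det_2:
  fixes A :: "'a \<Rightarrow> real^2^2"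
  assumes "(A \<longlongrightarrow> B) F"
  shows "((\<lambda>n. det (A n)) \<longlongrightarrow> det B) F"
  unfolding det_2 by (intro tendsto_intros assms)

lemma bounded_det1_subsequence:
  fixes A :: "nat \<Rightarrow> real^2^2"
  assumes det: "\<And>n. det (A n) = 1" and bdd: "\<And>n. norm (A n) \<le> K"
  obtains B s where "strict_mono (s :: nat \<Rightarrow> nat)" "(A \<circ> s) \<longlonglongrightarrow> B" "det B = 1"
proof -
  have "bounded (range A)"
    unfolding bounded_iff using bdd by blast
  then obtain B s where s: "strict_mono (s :: nat \<Rightarrow> nat)" "(A \<circ> s) \<longlonglongrightarrow> B"
    using bounded_imp_convergent_subsequence by blast
  have "(\<lambda>n. det ((A \<circ> s) n)) \<longlonglongrightarrow> det B"
    by (rule tendsto_det_2[OF s(2)])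
  then have "det B = 1"
    using det by (simp add: LIMSEQ_const_iff)
  with s show ?thesis using that by blast
qed

text \<open>A limit \<open>B\<close> of bounded lifts still has determinant 1, so along a further
  subsequence the orbit of every point w of the half-plane converges to the point
  \<open>hmap B w\<close> of the half-plane.\<close>

lemma bounded_subsequence_not_escaping:
  assumes r: "strict_mono (r :: nat \<Rightarrow> nat)" and F: "\<And>k. F (r k) = mob (A k)"
    and det: "\<And>k. det (A k) = 1" and bdd: "\<And>k. norm (A k) \<le> K"
  shows "\<not> escaping F"
proof -
  obtain B s where s: "strict_mono (s :: nat \<Rightarrow> nat)" "(A \<circ> s) \<longlonglongrightarrow> B" "det B = 1"
    using bounded_det1_subsequence[of A K, OF det bdd] by blast
  have "\<exists>r. strict_mono (r :: nat \<Rightarrow> nat) \<and> (\<exists>z\<in>upper_half_plane. (\<lambda>n. F (r n) (Pt w)) \<longlonglongrightarrow> Pt z)"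
    if "w \<in> upper_half_plane" for w
  proof (intro exI[of _ "r \<circ> s"] conjI bexI[of _ "hmap B w"])
    have w: "Im w > 0" using that by (simp add: upper_half_plane_def)
    show "strict_mono (r \<circ> s)" using r s(1) by (rule strict_mono_o)
    show "hmap B w \<in> upper_half_plane"
      using Im_hmap[OF s(3) w] by (simp add: upper_half_plane_def)
    have "F ((r \<circ> s) n) (Pt w) = Pt (hmap ((A \<circ> s) n) w)" for n
      unfolding o_apply F by (rule mob_Pt[OF det w])
    then show "(\<lambda>n. F ((r \<circ> s) n) (Pt w)) \<longlonglongrightarrow> Pt (hmap B w)"
      using tendsto_Pt[OF tendsto_hmap[OF s(2,3) w]] by presburger
  qed
  then show ?thesis unfolding escaping_def by blast
qed

text \<open>The link between matrices and the sphere: with squared row norms R1, R2 and row product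
  X the image of \<i> is (X + \<i>) / R2. One coordinate records the norm and thus escape; the other
  two are Gram entries and record the limit point.\<close>

lemma stereo_mob_i:
  assumes "det A = 1"
  shows "stereo (mob A (Pt \<i>)) =
    (Complex (2 * gram A (axis 1 1) (perp (axis 1 1))) (2 / (norm A)\<^sup>2), 2 * gram A (axis 1 1) (axis 1 1) - 1)"
proof -
  define a b c d where "a = A$1$1" and "b = A$1$2" and "c = A$2$1" and "d = A$2$2"
  define R1 R2 X where "R1 = a\<^sup>2 + b\<^sup>2" and "R2 = c\<^sup>2 + d\<^sup>2" and "X = a * c + b * d"
  have D: "a * d - b * c = 1" using assms by (simp add: det_2 a_def b_def c_def d_def)
  have R2: "R2 > 0"
    unfolding R2_def using D by (auto simp: sum_power2_gt_zero_iff)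
  have R1: "R1 \<ge> 0" by (simp add: R1_def)
  have N: "(norm A)\<^sup>2 = R1 + R2"
    unfolding norm_matrix_2_power2 norm_real2_power2 by (simp add: R1_def R2_def a_def b_def c_def d_def)
  have g1: "gram A (axis 1 1) (axis 1 1) = R1 / (R1 + R2)" and g2: "gram A (axis 1 1) (perp (axis 1 1)) = X / (R1 + R2)"
    unfolding gram_def N inner_real2 vector_matrix_mult_2 perp_nth
    by (simp_all add: axis_def R1_def X_def a_def b_def c_def d_def power2_eq_square)
  define z where "z = hmap A \<i>"
  have z_def': "z = Complex b a / Complex d c"
    unfolding z_def hmap_def a_def b_def c_def d_def by (simp add: complex_eq_iff Re_divide Im_divide)
  have z: "z = Complex (X / R2) (1 / R2)"
    unfolding z_def' using R2 D
    by (simp add: complex_eq_iff Re_divide Im_divide X_def R2_def algebra_simps)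
  have nz: "(cmod z)\<^sup>2 = R1 / R2"
  proof -
    have "(cmod z)\<^sup>2 = (cmod (Complex b a))\<^sup>2 / (cmod (Complex d c))\<^sup>2"
      unfolding z_def' norm_divide power_divide ..
    then show ?thesis
      by (simp add: cmod_power2 R1_def R2_def add.commute)
  qed
  have "stereo (Pt z) = (of_real (2 / (1 + R1 / R2)) * z, (R1 / R2 - 1) / (1 + R1 / R2))"
    by (simp add: nz)
  also have "2 / (1 + R1 / R2) = 2 * R2 / (R1 + R2)"
    using R2 R1 by (simp add: field_simps)
  also have "of_real (2 * R2 / (R1 + R2)) * z = Complex (2 * (X / (R1 + R2))) (2 / (R1 + R2))"
    unfolding z using R2 R1 by (simp add: complex_eq_iff)
  also have "(R1 / R2 - 1) / (1 + R1 / R2) = 2 * (R1 / (R1 + R2)) - 1"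
    using R2 R1 by (simp add: divide_simps)
  finally show ?thesis
    using assms by (simp add: mob_Pt z_def[symmetric] g1 g2 N)
qed

lemma not_escaping_bounded_subsequence:
  assumes F: "\<not> escaping F" and M: "\<And>n. F n = mob (M n)" "\<And>n. det (M n) = 1"
  obtains r K where "strict_mono (r :: nat \<Rightarrow> nat)" "\<And>n. norm (M (r n)) \<le> K"
proof -
  have "\<i> \<in> upper_half_plane" by (simp add: upper_half_plane_def)
  then obtain r z where r: "strict_mono (r :: nat \<Rightarrow> nat)" and z: "z \<in> upper_half_plane"
    and lim: "(\<lambda>n. F (r n) (Pt \<i>)) \<longlonglongrightarrow> Pt z"
    using F unfolding escaping_def by blast
  have "(\<lambda>n. Im (fst (stereo (F (r n) (Pt \<i>))))) \<longlonglongrightarrow> Im (fst (stereo (Pt z)))"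
    by (intro tendsto_Im tendsto_fst tendsto_stereo lim)
  then have "(\<lambda>n. 2 / (norm (M (r n)))\<^sup>2) \<longlonglongrightarrow> Im (fst (stereo (Pt z)))"
    by (simp add: M stereo_mob_i del: stereo.simps)
  moreover have "Im (fst (stereo (Pt z))) \<noteq> 0"
    using z by (simp add: upper_half_plane_def) (smt (verit) zero_le_power2)
  \<comment> \<open>A limit in the half-plane has nonzero imaginary coordinate on the sphere, so
    reciprocals may be taken and the squared norms converge.\<close>
  ultimately have "(\<lambda>n. 2 / (2 / (norm (M (r n)))\<^sup>2)) \<longlonglongrightarrow> 2 / Im (fst (stereo (Pt z)))"
    by (intro tendsto_divide tendsto_const)
  then have "bounded (range (\<lambda>n. 2 / (2 / (norm (M (r n)))\<^sup>2)))"
    by (rule convergent_imp_bounded)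
  then obtain K where K: "\<And>n. (norm (M (r n)))\<^sup>2 \<le> K"
    unfolding bounded_iff by auto
  have "norm (M (r n)) \<le> K" for n
  proof -
    have "1 \<le> norm (M (r n))"
      using norm_matrix_ge_sqrt2[OF M(2), of "r n"] power2_le_imp_le[of 1 "norm (M (r n))"] by simp
    then have "norm (M (r n)) \<le> (norm (M (r n)))\<^sup>2"
      using mult_left_mono[of 1 "norm (M (r n))" "norm (M (r n))"] by (simp add: power2_eq_square)
    then show ?thesis using K[of n] by linarith
  qed
  then show ?thesis using that r by blast
qed

section \<open>Neighbourhoods of the identity\<close>

lemma in_derived_set_of_moebius_topology:
  assumes S: "S \<subseteq> moebius_group"
  shows "id \<in> moebius_topology derived_set_of S \<longleftrightarrow>
    (\<forall>e>0. \<exists>g\<in>S. g \<noteq> id \<and> (\<forall>x. dist (g x) x \<le> e))"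
proof -
  let ?m = "funspace UNIV (euclidean_metric :: ecomplex metric) :: (ecomplex \<Rightarrow> ecomplex) metric"
  interpret Metric_space "mspace ?m" "mdist ?m"
    by (rule Metric_space_mspace_mdist)
  have mem: "f \<in> mspace ?m" for f
    by (simp only: mspace_funspace_ecomplex UNIV_I)
  have le: "mdist ?m f g \<le> a \<longleftrightarrow> (\<forall>x. dist (f x) (g x) \<le> a)" for f g a
    using Urysohn.funspace_mdist_le[OF mem mem, of f g a] by simp
  have ball: "y \<in> mball x r \<longleftrightarrow> mdist ?m x y < r" for x y r
    using mem by (simp only: in_mball simp_thms)
  have "id \<in> moebius_topology derived_set_of S \<longleftrightarrow> (\<forall>r>0. \<exists>y\<in>S. y \<noteq> id \<and> mdist ?m id y < r)"
    unfolding moebius_topology_def derived_set_of_subtopology mtopology_of_def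
    using id_in_moebius_group S mem
    by (simp only: metric_derived_set_of ball Int_iff mem_Collect_eq simp_thms Int_absorb1)
  also have "\<dots> \<longleftrightarrow> (\<forall>e>0. \<exists>g\<in>S. g \<noteq> id \<and> (\<forall>x. dist (g x) x \<le> e))"
  proof (intro iffI allI impI)
    fix e :: real
    assume "\<forall>r>0. \<exists>y\<in>S. y \<noteq> id \<and> mdist ?m id y < r" "e > 0"
    then obtain g where "g \<in> S" "g \<noteq> id" "mdist ?m id g \<le> e" by (meson less_imp_le)
    then show "\<exists>g\<in>S. g \<noteq> id \<and> (\<forall>x. dist (g x) x \<le> e)"
      unfolding le by (auto simp: dist_commute)
  next
    fix r :: real
    assume H: "\<forall>e>0. \<exists>g\<in>S. g \<noteq> id \<and> (\<forall>x. dist (g x) x \<le> e)" and r: "r > 0"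
    \<comment> \<open>A pointwise bound yields only a weak inequality for the supremum distance;
      halving makes it strict.\<close>
    then obtain g where "g \<in> S" "g \<noteq> id" "\<forall>x. dist (g x) x \<le> r / 2" by (meson half_gt_zero)
    moreover from this have "mdist ?m id g \<le> r / 2"
      unfolding le by (simp add: dist_commute)
    ultimately show "\<exists>y\<in>S. y \<noteq> id \<and> mdist ?m id y < r"
      using r by (intro bexI[of _ g]) auto
  qed
  finally show ?thesis .
qed

text \<open>In homogeneous coordinates the chordal distance of (n, m) and (z, 1) is 2 |n - z m|
  divided by the product of the Euclidean norms, and \<open>A\<close> moves (z, 1) by a small
  multiple of its norm. The point \<open>Infty\<close> is treated separately.\<close>

lemma dist_mob_le:
  assumes det: "det A = 1" and e: "norm (A - mat 1) \<le> e" "e \<le> 1/8"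
  shows "dist (mob A x) x \<le> 16 * e"
proof -
  define a b c d where "a = A$1$1" and "b = A$1$2" and "c = A$2$1" and "d = A$2$2"
  have ent: "\<bar>(A - mat 1)$i$j\<bar> \<le> e" for i j
    using component_le_norm_cart e(1) by (meson Finite_Cartesian_Product.norm_nth_le order_trans)
  have abcd: "\<bar>a - 1\<bar> \<le> e" "\<bar>b\<bar> \<le> e" "\<bar>c\<bar> \<le> e" "\<bar>d - 1\<bar> \<le> e"
    using ent[of 1 1] ent[of 1 2] ent[of 2 1] ent[of 2 2]
    by (simp_all add: a_def b_def c_def d_def)
  have e0: "0 \<le> e" using abcd(1) by linarith
  have mA: "mob A = moebius a b c d" by (simp add: mob_def a_def b_def c_def d_def)
  show ?thesis
  proof (cases x)
    case Infty
    show ?thesis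
    proof (cases "c = 0")
      case True
      then show ?thesis using Infty e0 by (simp add: mA)
    next
      case False
      have a: "a > 1/2" using abcd(1) e(2) by linarith
      have "\<bar>c\<bar> * (1/2) \<le> e * sqrt (c\<^sup>2 + a\<^sup>2)"
      proof (intro mult_mono abcd e0)
        have "a \<le> sqrt (c\<^sup>2 + a\<^sup>2)"
          by (rule real_le_rsqrt) simp
        then show "1/2 \<le> sqrt (c\<^sup>2 + a\<^sup>2)" using a by linarith
      qed auto
      moreover have "sqrt (1 + (a / c)\<^sup>2) = sqrt (c\<^sup>2 + a\<^sup>2) / \<bar>c\<bar>"
        using False by (simp add: power_divide real_sqrt_divide[symmetric] add_divide_distrib flip: real_sqrt_abs)
      moreover have "sqrt (c\<^sup>2 + a\<^sup>2) > 0" using False by (simp add: sum_power2_gt_zero_iff)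
      ultimately have "2 / sqrt (1 + (a / c)\<^sup>2) \<le> 16 * e"
        using False e0 by (simp add: divide_le_eq)
      then show ?thesis
        using Infty False by (simp add: mA dist_Pt_Infty norm_divide power_divide)
    qed
  next
    case (Pt z)
    define n m where "n = of_real a * z + of_real b" and "m = of_real c * z + of_real d"
    define u h where "u = sqrt (1 + (cmod z)\<^sup>2)" and "h = sqrt ((cmod n)\<^sup>2 + (cmod m)\<^sup>2)"
    have u: "1 \<le> u" "cmod z \<le> u"
      unfolding u_def by (auto intro: real_le_rsqrt)
    have nz: "cmod (n - z) \<le> 2 * e * u"
    proof -
      have "n - z = of_real (a - 1) * z + of_real b" by (simp add: n_def algebra_simps)
      then have "cmod (n - z) \<le> \<bar>a - 1\<bar> * cmod z + \<bar>b\<bar> * 1"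
        by (metis mult.right_neutral norm_mult norm_of_real norm_triangle_ineq)
      also have "\<dots> \<le> e * u + e * u"
        by (intro add_mono mult_mono abcd u) (use e0 in auto)
      finally show ?thesis by simp
    qed
    have m1: "cmod (m - 1) \<le> 2 * e * u"
    proof -
      have "m - 1 = of_real c * z + of_real (d - 1)" by (simp add: m_def)
      then have "cmod (m - 1) \<le> \<bar>c\<bar> * cmod z + \<bar>d - 1\<bar> * 1"
        by (metis mult.right_neutral norm_mult norm_of_real norm_triangle_ineq)
      also have "\<dots> \<le> e * u + e * u"
        by (intro add_mono mult_mono abcd u) (use e0 in auto)
      finally show ?thesis by simp
    qed
    \<comment> \<open>With \<open>e\<close> at most 1/8 the perturbation of (z, 1) has norm at most
      4 e u \<le> u / 2.\<close>
    have h: "u / 2 \<le> h"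
    proof -
      have "norm (z, 1 :: complex) = u" "norm (n, m) = h"
        by (simp_all add: norm_Pair u_def h_def add.commute)
      moreover have "norm (z, 1 :: complex) \<le> norm (n, m) + norm (n - z, m - 1)"
        using norm_triangle_ineq4[of "(n, m)" "(n - z, m - 1)"] by simp
      moreover have "norm (n - z, m - 1) \<le> cmod (n - z) + cmod (m - 1)"
        unfolding norm_Pair by (rule sqrt_sum_squares_le_sum) auto
      moreover have "e * u \<le> 1/8 * u" using e(2) u(1) by (intro mult_right_mono) auto
      ultimately show ?thesis using nz m1 by linarith
    qed
    have num: "cmod (n - z * m) \<le> 4 * e * u\<^sup>2"
    proof -
      have "n - z * m = (n - z) - z * (m - 1)" by (simp add: algebra_simps)
      then have "cmod (n - z * m) \<le> cmod (n - z) + cmod z * cmod (m - 1)"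
        by (metis norm_mult norm_triangle_ineq4)
      also have "\<dots> \<le> u * (2 * e * u) + u * (2 * e * u)"
      proof (intro add_mono mult_mono u m1)
        have "1 * (2 * e * u) \<le> u * (2 * e * u)" using u e0 by (intro mult_right_mono) auto
        then show "cmod (n - z) \<le> u * (2 * e * u)" using nz by linarith
      qed (use u in auto)
      finally show ?thesis by (simp add: power2_eq_square mult_ac)
    qed
    have h0: "h > 0" using h u by linarith
    have "dist (mob A x) x = 2 * cmod (n - z * m) / (h * u)"
    proof (cases "m = 0")
      case True
      then have "h = cmod n" by (simp add: h_def)
      then show ?thesis
        using True Pt h0 unfolding mA by (simp add: m_def[symmetric] dist_commute[of Infty] dist_Pt_Infty u_def)
    next
      case False
      have "1 + (cmod (n / m))\<^sup>2 = (h / cmod m)\<^sup>2"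
        using False by (simp add: h_def norm_divide power_divide add_divide_distrib)
      then have "sqrt (1 + (cmod (n / m))\<^sup>2) = h / cmod m"
        using h0 by simp
      moreover have "cmod (n / m - z) = cmod (n - z * m) / cmod m"
        using False by (simp add: norm_divide[symmetric] diff_divide_distrib)
      moreover have "dist (mob A x) x = dist (Pt (n / m)) (Pt z)"
        using False Pt unfolding mA by (simp add: m_def[symmetric] n_def[symmetric])
      ultimately show ?thesis
        using False by (simp add: dist_Pt_Pt u_def)
    qed
    also have "\<dots> \<le> 2 * (4 * e * u\<^sup>2) / (u / 2 * u)"
      using num h u e0 by (intro frac_le mult_mono mult_left_mono) auto
    also have "\<dots> = 16 * e"
      using u by (simp add: power2_eq_square)
    finally show ?thesis .
  qed
qed

text \<open>Convergence at \<i> alone bounds the lifts, so some subsequence converges; its limit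
  fixes the half-plane pointwise. The sign remains open because a transformation determines its lift
  only up to sign.\<close>

lemma tendsto_mob_id_subsequence:
  assumes det: "\<And>n. det (A n) = 1"
    and lim: "\<And>x. (\<lambda>n. mob (A n) x) \<longlonglongrightarrow> x"
  obtains r B where "strict_mono (r :: nat \<Rightarrow> nat)" "(A \<circ> r) \<longlonglongrightarrow> B" "B = mat 1 \<or> B = - mat 1"
proof -
  have "(\<lambda>n. Im (fst (stereo (mob (A n) (Pt \<i>))))) \<longlonglongrightarrow> Im (fst (stereo (Pt \<i>)))"
    by (intro tendsto_Im tendsto_fst tendsto_stereo lim)
  then have "(\<lambda>n. 2 / (norm (A n))\<^sup>2) \<longlonglongrightarrow> 1"
    by (simp add: det stereo_mob_i)
  then have "\<forall>\<^sub>F n in sequentially. 1/2 < 2 / (norm (A n))\<^sup>2"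
    by (rule order_tendstoD) simp
  then obtain N where N: "\<And>n. n \<ge> N \<Longrightarrow> 1/2 < 2 / (norm (A n))\<^sup>2"
    unfolding eventually_sequentially by blast
  \<comment> \<open>Only a tail is bounded; the shift by \<open>N\<close> is put back in the index
    sequence \<open>r\<close>.\<close>
  have "norm (A (n + N)) \<le> 2" for n
  proof (rule power2_le_imp_le)
    have "(norm (A (n + N)))\<^sup>2 > 0" using norm_matrix_ge_sqrt2[OF det, of "n + N"] by linarith
    then show "(norm (A (n + N)))\<^sup>2 \<le> 2\<^sup>2" using N[of "n + N"] by (simp add: field_simps)
  qed simp
  from bounded_det1_subsequence[of "\<lambda>n. A (n + N)", OF det this]
  obtain B s where s: "strict_mono (s :: nat \<Rightarrow> nat)" "((\<lambda>n. A (n + N)) \<circ> s) \<longlonglongrightarrow> B" "det B = 1"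
    by blast
  define r where "r n = s n + N" for n
  have r: "strict_mono r" "(A \<circ> r) \<longlonglongrightarrow> B"
    using s by (auto simp: r_def strict_mono_def o_def)
  have fixed: "hmap B w = w" if "Im w > 0" for w
  proof -
    have "(\<lambda>n. mob ((A \<circ> r) n) (Pt w)) \<longlonglongrightarrow> Pt w"
      using LIMSEQ_subseq_LIMSEQ[OF lim r(1)] by (simp add: o_def)
    moreover have "(\<lambda>n. mob ((A \<circ> r) n) (Pt w)) \<longlonglongrightarrow> Pt (hmap B w)"
      using tendsto_Pt[OF tendsto_hmap[OF r(2) s(3) that]] by (simp add: mob_Pt[OF det that])
    ultimately show ?thesis using LIMSEQ_unique by blast
  qed
  have eq: "of_real (B$1$1) * w + of_real (B$1$2) = w * (of_real (B$2$1) * w + of_real (B$2$2))" if "Im w > 0" for w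
    using fixed[OF that] hmap_denominator[OF s(3) that] by (simp add: hmap_def field_simps)
  \<comment> \<open>The fixed points \<i> and 2 \<i> already determine the matrix up to a
    scalar.\<close>
  have "B$1$1 = B$2$2" "B$1$2 = - (B$2$1)"
    using eq[of \<i>] by (simp_all add: complex_eq_iff)
  moreover have "B$1$2 = - 4 * B$2$1"
    using eq[of "2 * \<i>"] by (simp add: complex_eq_iff)
  ultimately have B: "B$1$1 = B$2$2" "B$1$2 = 0" "B$2$1 = 0" by simp_all
  then have "(B$2$2)\<^sup>2 = 1" using s(3) by (simp add: det_2 power2_eq_square)
  then have "B$2$2 = 1 \<or> B$2$2 = -1" by (simp add: power2_eq_1_iff)
  then have "B = mat 1 \<or> B = - mat 1"
    using B by (auto simp: vec_eq_iff forall_2)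
  with r show ?thesis using that by blast
qed

section \<open>Words and composition sequences\<close>

lemma foldr_comp_append: "foldr (\<circ>) (xs @ ys) id = foldr (\<circ>) xs id \<circ> foldr (\<circ>) ys id"
  by (induction xs) (simp_all add: o_assoc)

lemma generated_semigroup_word:
  assumes "s \<in> generated_semigroup \<F>"
  shows "\<exists>ws. ws \<noteq> [] \<and> set ws \<subseteq> \<F> \<and> s = foldr (\<circ>) ws id"
  using assms
proof induction
  case (generator f)
  then show ?case by (intro exI[of _ "[f]"]) simp
next
  case (comp f g)
  then obtain xs ys where "xs \<noteq> []" "set xs \<subseteq> \<F>" "f = foldr (\<circ>) xs id" "set ys \<subseteq> \<F>" "g = foldr (\<circ>) ys id"
    by blast
  then show ?case by (intro exI[of _ "xs @ ys"])
      (simp only: foldr_comp_append set_append Un_least append_is_Nil_conv simp_thms)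
qed

lemma partial_compositions_foldr:
  "partial_compositions f n = foldr (\<circ>) (map f [0..<Suc n]) id"
proof (induction n)
  case (Suc n)
  have "map f [0..<Suc (Suc n)] = map f [0..<Suc n] @ [f (Suc n)]" by simp
  moreover have "foldr (\<circ>) [f (Suc n)] id = f (Suc n)" by simp
  ultimately show ?case by (simp only: foldr_comp_append Suc partial_compositions.simps)
qed simp

text \<open>Each right multiplication that stays in \<open>P\<close> extends the current word in the
  generators. The nested words are prefixes of one infinite word, whose partial compositions meet
  \<open>P\<close> at the end of each prefix.\<close>

lemma composition_sequence_visiting:
  assumes P: "P \<subseteq> generated_semigroup \<F>" "P \<noteq> {}"
    and step: "\<And>u. u \<in> P \<Longrightarrow> \<exists>g\<in>generated_semigroup \<F>. u \<circ> g \<in> P"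
  obtains F r where "composition_sequence \<F> F" "strict_mono (r :: nat \<Rightarrow> nat)" "\<And>k. F (r k) \<in> P"
proof -
  let ?Q = "\<lambda>ws. ws \<noteq> [] \<and> set ws \<subseteq> \<F> \<and> foldr (\<circ>) ws id \<in> P"
  have "\<exists>L. \<forall>n. ?Q (L n) \<and> (\<exists>ws. ws \<noteq> [] \<and> L (Suc n) = L n @ ws)"
  proof (rule dependent_nat_choice)
    obtain u where "u \<in> P" using P by blast
    then show "\<exists>ws. ?Q ws" using generated_semigroup_word P by blast
  next
    fix ws :: "(ecomplex \<Rightarrow> ecomplex) list" and n :: nat
    assume ws: "?Q ws"
    then obtain g where "g \<in> generated_semigroup \<F>" "foldr (\<circ>) ws id \<circ> g \<in> P"
      using step by blast
    with generated_semigroup_word[of g \<F>] obtain vs where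
      "vs \<noteq> []" "set vs \<subseteq> \<F>" "foldr (\<circ>) ws id \<circ> foldr (\<circ>) vs id \<in> P" by blast
    with ws have "?Q (ws @ vs)" by (simp add: foldr_comp_append del: foldr_append)
    with \<open>vs \<noteq> []\<close> show "\<exists>L. ?Q L \<and> (\<exists>vs. vs \<noteq> [] \<and> L = ws @ vs)" by blast
  qed
  then obtain L where L: "\<And>n. ?Q (L n)" and L_Suc: "\<And>n. \<exists>ws. ws \<noteq> [] \<and> L (Suc n) = L n @ ws"
    by blast
  have len: "length (L n) < length (L (Suc n))" for n
    using L_Suc[of n] by auto
  then have mono: "strict_mono (\<lambda>n. length (L n))"
    by (simp add: strict_mono_Suc_iff)
  have long: "n < length (L n)" for n
  proof (induction n)
    case 0 then show ?case using L[of 0] by simp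
  next
    case (Suc n) then show ?case using len[of n] by linarith
  qed
  have prefix: "\<exists>ws. L j = L i @ ws" if "i \<le> j" for i j
    using that
  proof (induction rule: dec_induct)
    case (step n)
    then show ?case using L_Suc[of n] by (metis append.assoc)
  qed simp
  \<comment> \<open>The \<open>n\<close>-th word has more than \<open>n\<close> letters, and its
    letter at position \<open>n\<close> agrees with that of every other word long enough.\<close>
  define f where "f n = L n ! n" for n
  have nth: "L k ! n = f n" if "n < length (L k)" for k n
  proof (cases "n \<le> k")
    case True
    then obtain ws where "L k = L n @ ws" using prefix by blast
    then show ?thesis using long[of n] by (simp add: f_def nth_append)
  next
    case False
    then obtain ws where "L n = L k @ ws" using prefix[of k n] by auto
    then show ?thesis using that by (simp add: f_def nth_append)
  qed
  \<comment> \<open>The partial composition of index \<open>n\<close> has \<open>n + 1\<close>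
    factors.\<close>
  define r where "r k = length (L k) - 1" for k
  have r: "Suc (r k) = length (L k)" for k
    using long[of k] by (simp add: r_def)
  have "map f [0..<Suc (r k)] = L k" for k
    by (rule nth_equalityI) (simp_all add: r nth del: upt_Suc)
  then have "partial_compositions f (r k) \<in> P" for k
    using L[of k] by (simp only: partial_compositions_foldr)
  moreover have "strict_mono r"
    using mono r unfolding strict_mono_def by (metis Suc_less_eq)
  moreover have "range f \<subseteq> \<F>"
    using L nth_mem[OF long] unfolding f_def by blast
  ultimately show ?thesis
    using that[of "partial_compositions f" r] unfolding composition_sequence_def by blast
qed

lemma extended_real_stereo:
  assumes "x\<^sup>2 + y\<^sup>2 = (1::real)"
  shows "\<exists>p\<in>extended_reals. stereo p = (of_real x, y)"
proof (cases "y = 1")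
  case True
  then have "stereo Infty = (of_real x, y)" using assms by simp
  then show ?thesis unfolding extended_reals_def by blast
next
  case False
  \<comment> \<open>Inverse stereographic projection, restricted to the circle over the real
    line.\<close>
  define t where "t = x / (1 - y)"
  have y: "1 - y \<noteq> 0" using False by simp
  have "x\<^sup>2 = (1 - y) * (1 + y)" using assms by (simp add: power2_eq_square algebra_simps)
  then have t: "t\<^sup>2 = (1 + y) / (1 - y)"
    using y by (simp add: t_def power_divide power2_eq_square)
  have 1: "1 + t\<^sup>2 = 2 / (1 - y)" "t\<^sup>2 - 1 = 2 * y / (1 - y)"
    using y unfolding t by (simp_all add: field_simps)
  have xy: "2 / (1 + t\<^sup>2) * t = x" "(t\<^sup>2 - 1) / (1 + t\<^sup>2) = y"
    unfolding 1 using y by (simp_all add: t_def)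
  have "stereo (Pt (of_real t)) = (of_real x, y)"
    by (simp only: stereo.simps norm_of_real power2_abs of_real_mult[symmetric] xy)
  then show ?thesis unfolding extended_reals_def by blast
qed

text \<open>The sphere coordinates of the orbit of \<i> converge, with imaginary coordinate tending
  to 0. The limit has norm 1 as a limit of unit vectors, so it lies over an extended real
  point.\<close>

lemma converges_ideally_of_gram:
  assumes F: "\<And>n. F n = mob (M n)" and det: "\<And>n. det (M n) = 1" and esc: "escaping F"
    and unb: "filterlim (\<lambda>n. norm (M n)) at_top sequentially"
    and conv: "\<And>u v. convergent (\<lambda>n. gram (M n) u v)"
  shows "converges_ideally F"
proof -
  let ?e = "axis 1 1 :: real^2"
  obtain g1 where g1: "(\<lambda>n. gram (M n) ?e ?e) \<longlonglongrightarrow> g1" using conv convergent_def by blast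
  obtain g2 where g2: "(\<lambda>n. gram (M n) ?e (perp ?e)) \<longlonglongrightarrow> g2" using conv convergent_def by blast
  have "(\<lambda>n. 2 / (norm (M n))\<^sup>2) \<longlonglongrightarrow> 0"
    by (intro tendsto_divide_0[OF tendsto_const] filterlim_at_top_imp_at_infinity filterlim_pow_at_top unb) simp
  then have "(\<lambda>n. (Complex (2 * gram (M n) ?e (perp ?e)) (2 / (norm (M n))\<^sup>2), 2 * gram (M n) ?e ?e - 1))
      \<longlonglongrightarrow> (Complex (2 * g2) 0, 2 * g1 - 1)"
    by (intro tendsto_intros g1 g2)
  then have lim: "(\<lambda>n. stereo (F n (Pt \<i>))) \<longlonglongrightarrow> (of_real (2 * g2), 2 * g1 - 1)"
    by (simp add: F stereo_mob_i[OF det] complex_of_real_def)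
  have "norm (complex_of_real (2 * g2), 2 * g1 - 1) = 1"
    using tendsto_norm[OF lim] by (simp add: norm_stereo LIMSEQ_const_iff)
  then have "(2 * g2)\<^sup>2 + (2 * g1 - 1)\<^sup>2 = 1"
    using norm_Pair_power2[of "complex_of_real (2 * g2)" "2 * g1 - 1"] by (simp del: of_real_mult)
  then obtain p where p: "p \<in> extended_reals" "stereo p = (of_real (2 * g2), 2 * g1 - 1)"
    using extended_real_stereo by blast
  have "(\<lambda>n. F n (Pt \<i>)) \<longlonglongrightarrow> p"
    using lim unfolding p(2)[symmetric] tendsto_stereo_iff .
  moreover have "\<i> \<in> upper_half_plane" by (simp add: upper_half_plane_def)
  ultimately show ?thesis
    using p(1) esc unfolding converges_ideally_def by blast
qed

lemma generated_semigroup_subset: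
  assumes "\<F> \<subseteq> moebius_group"
  shows "generated_semigroup \<F> \<subseteq> moebius_group"
proof
  fix f assume "f \<in> generated_semigroup \<F>"
  then show "f \<in> moebius_group"
    by induction (use assms in \<open>blast intro: moebius_group_comp\<close>)+
qed

section \<open>The equivalence for a finite generating set\<close>

locale moebius_generators =
  fixes \<F> :: "(ecomplex \<Rightarrow> ecomplex) set"
  assumes in_group: "\<F> \<subseteq> moebius_group" and finite: "finite \<F>" and nonempty: "\<F> \<noteq> {}"
begin

definition lifts :: "(real^2^2) set" where
  "lifts = {A. det A = 1 \<and> mob A \<in> generated_semigroup \<F>}"

sublocale lifts: det1_semigroup lifts
  by unfold_locales (auto simp: lifts_def det_mul mob_mult intro: generated_semigroup.comp)

lemma generated_semigroup_lift:
  assumes "f \<in> generated_semigroup \<F>"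
  obtains A where "A \<in> lifts" "mob A = f"
  using moebius_group_mob[of f] generated_semigroup_subset[OF in_group] assms
  by (auto simp: lifts_def)

lemma lifts_nonempty: "lifts \<noteq> {}"
  using nonempty generated_semigroup_lift generated_semigroup.generator by blast

text \<open>The image of a trap under \<open>mob\<close> is visited infinitely often by a
  composition sequence, and the lifts chosen in \<open>P\<close> at these visits are
  bounded.\<close>

lemma bounded_trap_not_escaping:
  assumes P: "P \<subseteq> lifts" "P \<noteq> {}" "bounded P" and step: "\<And>u. u \<in> P \<Longrightarrow> \<exists>g\<in>lifts. u ** g \<in> P"
  obtains F where "composition_sequence \<F> F" "\<not> escaping F"
proof -
  have "mob ` P \<subseteq> generated_semigroup \<F>" "mob ` P \<noteq> {}"
    using P by (auto simp: lifts_def)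
  moreover have "\<exists>g\<in>generated_semigroup \<F>. f \<circ> g \<in> mob ` P" if f: "f \<in> mob ` P" for f
  proof -
    obtain u where u: "u \<in> P" "f = mob u" using f by blast
    then obtain g where "g \<in> lifts" "u ** g \<in> P" using step by blast
    with u P(1) have "mob g \<in> generated_semigroup \<F>" "f \<circ> mob g = mob (u ** g)"
      by (auto simp: lifts_def subset_iff mob_mult)
    then show ?thesis using \<open>u ** g \<in> P\<close> by (metis imageI)
  qed
  ultimately obtain F r where F: "composition_sequence \<F> F" "strict_mono (r :: nat \<Rightarrow> nat)" "\<And>k. F (r k) \<in> mob ` P"
    using composition_sequence_visiting[of "mob ` P" \<F>] by metis
  have "\<exists>A. A \<in> P \<and> F (r k) = mob A" for k
    using F(3)[of k] by blast
  then obtain A where A: "\<And>k. A k \<in> P" "\<And>k. F (r k) = mob (A k)"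
    by metis
  obtain K where K: "\<And>k. norm (A k) \<le> K"
    using P(3) A(1) unfolding bounded_iff by blast
  have "det (A k) = 1" for k
    using A(1) P(1) lifts.det1 by blast
  then have "\<not> escaping F"
    using bounded_subsequence_not_escaping[of r F A K] F(2) A(2) K by blast
  with F(1) show ?thesis using that by blast
qed

text \<open>One lift is fixed for each generator, so that only finitely many matrices occur as
  factors.\<close>

lemma composition_sequence_lift:
  assumes "composition_sequence \<F> F"
  obtains M A where "\<And>n. F n = mob (M n)" "\<And>n. M (Suc n) = M n ** A n" "M 0 \<in> lifts"
    "\<And>n. A n \<in> lifts" "finite (range A)"
proof -
  obtain f where f: "range f \<subseteq> \<F>" "F = partial_compositions f"
    using assms unfolding composition_sequence_def by blast
  have "\<forall>g\<in>\<F>. \<exists>A. A \<in> lifts \<and> mob A = g"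
    using generated_semigroup_lift generated_semigroup.generator by blast
  then obtain rep where rep: "\<And>g. g \<in> \<F> \<Longrightarrow> rep g \<in> lifts \<and> mob (rep g) = g"
    using bchoice by metis
  define A where "A n = rep (f (Suc n))" for n
  define M where "M = rec_nat (rep (f 0)) (\<lambda>n X. X ** A n)"
  have M: "M 0 = rep (f 0)" "M (Suc n) = M n ** A n" for n
    by (simp_all add: M_def)
  have A_in: "A n \<in> lifts" and M0: "M 0 \<in> lifts" for n
    using rep f(1) by (auto simp: A_def M)
  have M_in: "M n \<in> lifts" for n
    by (induction n) (simp_all add: M0 M(2) A_in lifts.mult_closed)
  have "F n = mob (M n)" for n
  proof (induction n)
    case 0
    then show ?case using rep[of "f 0"] f by (simp add: M image_subset_iff)
  next
    case (Suc n)
    moreover have "mob (A n) = f (Suc n)"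
      using rep[of "f (Suc n)"] f(1) by (simp add: A_def image_subset_iff)
    ultimately show ?case
      by (simp only: f(2) partial_compositions.simps M(2) mob_mult[OF lifts.det1[OF M_in] lifts.det1[OF A_in]])
  qed
  moreover have "range A \<subseteq> rep ` \<F>"
    using f(1) by (auto simp: A_def)
  then have "finite (range A)"
    using finite finite_subset by blast
  ultimately show ?thesis using that M(2) M0 A_in by blast
qed

lemma escaping_norm_at_top:
  assumes F: "\<And>n. F n = mob (M n)" and det: "\<And>n. det (M n) = 1" and esc: "escaping F"
  shows "filterlim (\<lambda>n. norm (M n)) at_top sequentially"
proof (rule ccontr)
  assume "\<not> ?thesis"
  then obtain K where "\<not> (\<forall>\<^sub>F n in sequentially. K \<le> norm (M n))"
    unfolding filterlim_at_top by blast
  then have "infinite {n. \<not> K \<le> norm (M n)}"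
    by (metis eventually_cofinite cofinite_eq_sequentially)
  then obtain r where r: "strict_mono (r :: nat \<Rightarrow> nat)" "\<And>n. \<not> K \<le> norm (M (r n))"
    using infinite_enumerate by (metis (mono_tags, lifting) mem_Collect_eq)
  have "norm (M (r n)) \<le> K" for n using r(2)[of n] by simp
  then have "\<not> escaping F"
    using bounded_subsequence_not_escaping[of r F "\<lambda>n. M (r n)" K] r(1) F det by blast
  with esc show False by simp
qed

context
  assumes all_escaping: "\<And>F. composition_sequence \<F> F \<Longrightarrow> escaping F"
begin

interpretation lifts: trapless_semigroup lifts
proof
  show "lifts \<noteq> {}" by (rule lifts_nonempty)
  show "\<exists>u\<in>P. \<forall>g\<in>lifts. u ** g \<notin> P" if "P \<subseteq> lifts" "P \<noteq> {}" "bounded P" for P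
    using bounded_trap_not_escaping[OF that] all_escaping by metis
qed

lemma converges_ideally_if_all_escaping:
  assumes F: "composition_sequence \<F> F"
  shows "converges_ideally F"
proof -
  obtain M A where M: "\<And>n. F n = mob (M n)" "\<And>n. M (Suc n) = M n ** A n" "M 0 \<in> lifts"
    "\<And>n. A n \<in> lifts" "finite (range A)"
    using composition_sequence_lift[OF F] by blast
  have M_in: "M n \<in> lifts" for n
    by (induction n) (simp_all add: M lifts.mult_closed)
  note det = lifts.det1[OF M_in] and esc = all_escaping[OF F]
  note unb = escaping_norm_at_top[OF M(1) det esc]
  interpret composition_in_semigroup lifts M A
    by unfold_locales (fact M lifts.det1[OF M(4)] det unb)+
  show ?thesis
    by (rule converges_ideally_of_gram[OF M(1) det esc unb convergent_gram_composition])
qed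

lemma identity_not_approximated:
  assumes "\<And>e. e > 0 \<Longrightarrow> \<exists>g\<in>generated_semigroup \<F>. \<forall>x. dist (g x) x \<le> e"
  shows False
proof -
  have "\<exists>A\<in>lifts. \<forall>x. dist (mob A x) x \<le> 1 / (real n + 1)" for n
    using assms[of "1 / (real n + 1)"] generated_semigroup_lift by (metis divide_pos_pos of_nat_0_le_iff add_nonneg_pos zero_less_one)
  then obtain A where A: "\<And>n. A n \<in> lifts" and le: "\<And>n x. dist (mob (A n) x) x \<le> 1 / (real n + 1)"
    by metis
  have lim0: "(\<lambda>n. 1 / (real n + 1)) \<longlonglongrightarrow> 0" by real_asymp
  have "(\<lambda>n. mob (A n) x) \<longlonglongrightarrow> x" for x
    unfolding tendsto_dist_iff[of _ x]
    by (rule tendsto_sandwich[OF _ _ tendsto_const lim0]) (use le in auto)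
  then obtain r B where r: "strict_mono (r :: nat \<Rightarrow> nat)" "(A \<circ> r) \<longlonglongrightarrow> B" "B = mat 1 \<or> B = - mat 1"
    using tendsto_mob_id_subsequence[of A, OF lifts.det1[OF A]] by blast
  obtain a where a: "a \<in> lifts" using lifts_nonempty by blast
  \<comment> \<open>The strict inequality leaves each member room for a small error, which may
    depend on the member.\<close>
  define P where "P = {u\<in>lifts. norm u < norm a + 1}"
  have "P \<subseteq> lifts" "a \<in> P" "bounded P"
    using a by (auto simp: P_def bounded_iff intro: less_imp_le)
  moreover have "\<exists>g\<in>lifts. u ** g \<in> P" if "u \<in> P" for u
  proof -
    \<comment> \<open>The limit of the lifts may be minus the identity, which does not change
      norms.\<close>
    have uB: "norm (u ** B) = norm u"
      using r(3) by (auto simp: matrix_minus_right)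
    have "(\<lambda>n. norm u * norm ((A \<circ> r) n - B)) \<longlonglongrightarrow> norm u * 0"
      using tendsto_norm_zero[OF LIM_zero[OF r(2)]] by (intro tendsto_mult tendsto_const)
    then have "\<forall>\<^sub>F n in sequentially. norm u * norm ((A \<circ> r) n - B) < norm a + 1 - norm u"
      using that by (intro order_tendstoD(2)) (auto simp: P_def)
    then obtain n where n: "norm u * norm ((A \<circ> r) n - B) < norm a + 1 - norm u"
      using eventually_happens' sequentially_bot by blast
    have "u ** (A \<circ> r) n = u ** B + u ** ((A \<circ> r) n - B)"
      by (simp add: matrix_sub_ldistrib)
    then have "norm (u ** (A \<circ> r) n) \<le> norm u + norm u * norm ((A \<circ> r) n - B)"
      using norm_triangle_ineq[of "u ** B" "u ** ((A \<circ> r) n - B)"] norm_matrix_mult_le[of u "(A \<circ> r) n - B"] uB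
      by simp
    with n A[of "r n"] that show ?thesis
      by (intro bexI[of _ "A (r n)"]) (auto simp: P_def lifts.mult_closed)
  qed
  ultimately show False
    using lifts.trapless[of P] by blast
qed

lemma semidiscrete_inverse_free_if_all_escaping:
  "semidiscrete (generated_semigroup \<F>) \<and> inverse_free (generated_semigroup \<F>)"
proof
  let ?S = "generated_semigroup \<F>"
  have sub: "?S \<subseteq> moebius_group" by (rule generated_semigroup_subset[OF in_group])
  show "semidiscrete ?S"
    unfolding semidiscrete_def in_derived_set_of_moebius_topology[OF sub]
    using identity_not_approximated by blast
  show "inverse_free ?S"
    unfolding inverse_free_def
  proof (intro ballI notI)
    fix f assume f: "f \<in> ?S" "inv f \<in> ?S"
    then have "f \<circ> inv f \<in> ?S" by (rule generated_semigroup.comp)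
    moreover have "f \<circ> inv f = id"
      using moebius_group_bij_inv(1)[of f] f(1) sub by (meson bij_is_surj subsetD surj_iff)
    ultimately have "id \<in> ?S" by simp
    then show False
      using identity_not_approximated by (metis dist_self id_apply less_imp_le)
  qed
qed

end

text \<open>Lifts along a nonescaping sequence have a convergent subsequence. Quotients of its
  consecutive terms represent elements of the semigroup that tend to the identity and differ from
  it, since an inverse free semigroup omits the identity.\<close>

lemma all_escaping_if_semidiscrete_inverse_free:
  assumes sd: "semidiscrete (generated_semigroup \<F>)" and ifree: "inverse_free (generated_semigroup \<F>)"
    and F: "composition_sequence \<F> F"
  shows "escaping F"
proof (rule ccontr)
  let ?S = "generated_semigroup \<F>"
  have sub: "?S \<subseteq> moebius_group" by (rule generated_semigroup_subset[OF in_group])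
  assume "\<not> escaping F"
  obtain M A where M: "\<And>n. F n = mob (M n)" "\<And>n. M (Suc n) = M n ** A n" "M 0 \<in> lifts"
    "\<And>n. A n \<in> lifts" "finite (range A)"
    using composition_sequence_lift[OF F] by blast
  have M_in: "M n \<in> lifts" for n
    by (induction n) (simp_all add: M lifts.mult_closed)
  note det = lifts.det1[OF M_in]
  obtain r K where r: "strict_mono (r :: nat \<Rightarrow> nat)" and K: "\<And>n. norm (M (r n)) \<le> K"
    using not_escaping_bounded_subsequence[of F M, OF \<open>\<not> escaping F\<close> M(1) det] by blast
  obtain B s where s: "strict_mono (s :: nat \<Rightarrow> nat)" "((\<lambda>n. M (r n)) \<circ> s) \<longlonglongrightarrow> B"
    using bounded_det1_subsequence[of "\<lambda>n. M (r n)" K, OF det K] by blast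
  define X where "X n = M (r (s n))" for n
  have X: "X \<longlonglongrightarrow> B" "\<And>n. norm (X n) \<le> K" "\<And>n. det (X n) = 1"
    using s(2) K det by (simp_all add: X_def[abs_def] o_def)
  have tail: "\<exists>g\<in>lifts. X (Suc n) = X n ** g" for n
  proof -
    have "r (s n) < r (s (Suc n))" using r s(1) by (simp add: strict_mono_less)
    then show ?thesis
      using lifts.product_tail[of M A, OF M(2,4)] unfolding X_def by blast
  qed
  have id: "id \<notin> ?S"
    using ifree unfolding inverse_free_def by (metis inv_id)
  have "\<exists>g\<in>?S. g \<noteq> id \<and> (\<forall>x. dist (g x) x \<le> e)" if e: "e > 0" for e
  proof -
    \<comment> \<open>The constants 16 and 1/8 are those of \<open>dist_mob_le\<close>.\<close>
    define d where "d = min (e / 16) (1 / 8)"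
    have d: "d > 0" "d \<le> 1/8" "16 * d \<le> e" using e by (auto simp: d_def)
    have "(\<lambda>n. K * norm (X (Suc n) - X n)) \<longlonglongrightarrow> K * norm (B - B)"
      by (intro tendsto_intros LIMSEQ_Suc X)
    then have "\<forall>\<^sub>F n in sequentially. K * norm (X (Suc n) - X n) < d"
      using d(1) by (intro order_tendstoD(2)) auto
    then obtain n where n: "K * norm (X (Suc n) - X n) < d"
      using eventually_happens' sequentially_bot by blast
    obtain g where g: "g \<in> lifts" "X (Suc n) = X n ** g" using tail by blast
    \<comment> \<open>The inverse of \<open>X n\<close> is its adjugate, whose norm equals that of
      \<open>X n\<close> and is therefore bounded by \<open>K\<close>.\<close>
    have "g - mat 1 = adjugate (X n) ** (X (Suc n) - X n)"
      by (simp add: g(2) matrix_sub_ldistrib matrix_mul_assoc adjugate_mult[OF X(3)])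
    then have "norm (g - mat 1) \<le> norm (adjugate (X n)) * norm (X (Suc n) - X n)"
      using norm_matrix_mult_le by metis
    also have "\<dots> \<le> K * norm (X (Suc n) - X n)"
      using X(2)[of n] by (intro mult_right_mono) (simp_all add: norm_adjugate)
    finally have "norm (g - mat 1) \<le> d" using n by linarith
    from dist_mob_le[OF lifts.det1[OF g(1)] this d(2)]
    have "\<forall>x. dist (mob g x) x \<le> e" using d(3) by (meson order_trans)
    moreover have "mob g \<in> ?S" using g(1) by (simp add: lifts_def)
    ultimately show ?thesis using id by metis
  qed
  then have "id \<in> moebius_topology derived_set_of ?S"
    unfolding in_derived_set_of_moebius_topology[OF sub] by blast
  with sd show False unfolding semidiscrete_def by blast
qed

end

theorem theorem1p3:
  fixes \<F> S :: "(ecomplex \<Rightarrow> ecomplex) set"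
  assumes "\<F> \<subseteq> moebius_group" and "finite \<F>" and "\<F> \<noteq> {}"
    and "S = generated_semigroup \<F>"
  shows "((\<forall>F. composition_sequence \<F> F \<longrightarrow> escaping F) \<longleftrightarrow>
          (\<forall>F. composition_sequence \<F> F \<longrightarrow> converges_ideally F)) \<and>
         ((\<forall>F. composition_sequence \<F> F \<longrightarrow> converges_ideally F) \<longleftrightarrow>
          semidiscrete S \<and> inverse_free S)"
proof -
  interpret moebius_generators \<F>
    by unfold_locales (fact assms)+
  have "converges_ideally F \<Longrightarrow> escaping F" for F
    by (simp add: converges_ideally_def)
  then show ?thesis
    unfolding assms(4)
    using converges_ideally_if_all_escaping semidiscrete_inverse_free_if_all_escaping
      all_escaping_if_semidiscrete_inverse_free by metis
qed

end
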